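(* Let $\mathbb{K}$ be $\mathbb{R}$ or $\mathbb{C}$, and let $C$ be an $m\times m\times m$ tensor (with entries in $\mathbb{K}$) that is a generic point in the universal variety $\mathcal{U}_{m,3}$. Then the stabilizer of $C$ under the congruence action by $\mathrm{GL}(m,\mathbb{K})$ is trivial, i.e. $$\{X\in\mathrm{GL}(m,\mathbb{K}) : [\![C;X,X,X]\!]=C\}=\{\eta I : \eta\in\mathbb{K},\ \eta^3=1\}.$$
   Context: For $C=(c_{ijk})\in\mathbb{K}^{m\times m\times m}$ and $X=(x_{ij})\in\mathbb{K}^{m\times m}$, $[\![C;X,X,X]\!]_{\alpha\beta\gamma}=\sum_{i,j,k=1}^m c_{ijk}\,x_{\alpha i}x_{\beta j}x_{\gamma k}$. The universal variety $\mathcal{U}_{m,3}\subset(\mathbb{C}^m)^{\otimes 3}$ is the (irreducible, affine) variety of all third order signature tensors of paths $\psi:[0,1]\to\mathbb{C}^m$, where the third order signature has entries $c_{ijk}=\int_0^1\left(\int_0^{t_3}\left(\int_0^{t_2}\mathrm{d}\psi_i(t_1)\right)\mathrm{d}\psi_j(t_2)\right)\mathrm{d}\psi_k(t_3)$. Concretely, it is parametrized (up to Zariski closure) by the tensors $$C=\tfrac16 P^{\otimes 3}+\tfrac12\,(P\otimes Q+Q\otimes P)+L,$$ where $P\in\mathbb{C}^m$ is a vector, $Q\in\mathbb{C}^m\otimes\mathbb{C}^m$ is a skew-symmetric matrix, and $L\in\mathrm{Lie}^{[3]}(\mathbb{C}^m)$ is a homogeneous Lie polynomial of degree $3$, i.e.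 an element of the linear span in $(\mathbb{C}^m)^{\otimes 3}$ of all iterated commutators $[a,[b,c]]$, $a,b,c\in\mathbb{C}^m$, computed in the tensor algebra; this is the degree $3$ component of $\exp(P+Q+L)$ in the tensor algebra. "Generic" means: there is a proper Zariski closed subset of $\mathcal{U}_{m,3}$ such that the assertion holds for all points $C$ of $\mathcal{U}_{m,3}$ outside it (all real points outside it when $\mathbb{K}=\mathbb{R}$). *)

theory Defs
  imports "HOL-Analysis.Analysis"
begin

text \<open>Third order tensors of format \<open>m \<times> m \<times> m\<close> over \<open>'a\<close> are the vectors
  \<open>'a ^ ('m \<times> 'm \<times> 'm)\<close> with \<open>m = CARD('m)\<close>. The flat index type makes the \<open>'a\<close>-linear
  scaling \<open>*s\<close> and \<open>vec.span\<close> available; \<open>scaleR\<close> and \<open>span\<close> are only real-linear.\<close>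

type_synonym ('a, 'm) tensor3 = "'a ^ ('m \<times> 'm \<times> 'm)"

definition congruence :: "('a::comm_ring_1, 'm::finite) tensor3 \<Rightarrow> 'a ^ 'm ^ 'm \<Rightarrow> ('a, 'm) tensor3"
  where "congruence C X = (\<chi> t. case t of (\<alpha>, \<beta>, \<gamma>) \<Rightarrow>
    \<Sum>i\<in>UNIV. \<Sum>j\<in>UNIV. \<Sum>k\<in>UNIV. C $ (i, j, k) * X $ \<alpha> $ i * X $ \<beta> $ j * X $ \<gamma> $ k)"

definition GL_stabilizer :: "('a::comm_ring_1, 'm::finite) tensor3 \<Rightarrow> ('a ^ 'm ^ 'm) set"
  where "GL_stabilizer C = {X. invertible X \<and> congruence C X = C}"


subsection \<open>Tensor products and Lie polynomials of degree 3\<close>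

definition tensor_vv :: "'a::comm_ring_1 ^ 'm \<Rightarrow> 'a ^ 'm \<Rightarrow> 'a ^ 'm ^ 'm"
  where "tensor_vv a b = (\<chi> i j. a $ i * b $ j)"

definition tensor_vm :: "'a::comm_ring_1 ^ 'm \<Rightarrow> 'a ^ 'm ^ 'm \<Rightarrow> ('a, 'm::finite) tensor3"
  where "tensor_vm a M = (\<chi> t. case t of (i, j, k) \<Rightarrow> a $ i * M $ j $ k)"

definition tensor_mv :: "'a::comm_ring_1 ^ 'm ^ 'm \<Rightarrow> 'a ^ 'm \<Rightarrow> ('a, 'm::finite) tensor3"
  where "tensor_mv M a = (\<chi> t. case t of (i, j, k) \<Rightarrow> M $ i $ j * a $ k)"

definition bracket_vv :: "'a::comm_ring_1 ^ 'm \<Rightarrow> 'a ^ 'm \<Rightarrow> 'a ^ 'm ^ 'm"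
  where "bracket_vv b c = tensor_vv b c - tensor_vv c b"

definition bracket_vm :: "'a::comm_ring_1 ^ 'm \<Rightarrow> 'a ^ 'm ^ 'm \<Rightarrow> ('a, 'm::finite) tensor3"
  where "bracket_vm a M = tensor_vm a M - tensor_mv M a"

definition Lie3 :: "('a::field, 'm::finite) tensor3 set"
  where "Lie3 = vec.span {bracket_vm a (bracket_vv b c) | a b c. True}"


subsection \<open>Zariski topology on complex affine space\<close>

text \<open>\<open>real_polynomial_function\<close> of the library is real-linear and would admit complex
  conjugation, so the complex polynomial functions are generated by the coordinates.\<close>

inductive poly_fun :: "(complex ^ 'n \<Rightarrow> complex) \<Rightarrow> bool" where
  const: "poly_fun (\<lambda>x. c)"
| coord: "poly_fun (\<lambda>x. x $ i)"
| add: "poly_fun f \<Longrightarrow> poly_fun g \<Longrightarrow> poly_fun (\<lambda>x. f x + g x)"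
| mult: "poly_fun f \<Longrightarrow> poly_fun g \<Longrightarrow> poly_fun (\<lambda>x. f x * g x)"

definition zariski_closed :: "(complex ^ 'n) set \<Rightarrow> bool"
  where "zariski_closed S \<longleftrightarrow>
    (\<exists>F. (\<forall>f\<in>F. poly_fun f) \<and> S = {x. \<forall>f\<in>F. f x = 0})"

definition holds_generically :: "(complex ^ 'n) set \<Rightarrow> (complex ^ 'n \<Rightarrow> bool) \<Rightarrow> bool"
  where "holds_generically V A \<longleftrightarrow>
    (\<exists>Z. zariski_closed Z \<and> Z \<subset> V \<and> (\<forall>x \<in> V - Z. A x))"


subsection \<open>The universal variety\<close>

text \<open>Degree 3 component of \<open>exp (P + Q + L)\<close> in the tensor algebra, for \<open>P\<close>, \<open>Q\<close>, \<open>L\<close>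
  homogeneous of degree 1, 2, 3.\<close>

definition exp_deg3 :: "'a::field ^ 'm \<Rightarrow> 'a ^ 'm ^ 'm \<Rightarrow> ('a, 'm::finite) tensor3 \<Rightarrow> ('a, 'm) tensor3"
  where "exp_deg3 P Q L =
    (1/6) *s tensor_vm P (tensor_vv P P) + (1/2) *s (tensor_vm P Q + tensor_mv Q P) + L"

text \<open>The parametrized set itself need not be closed; \<open>hull\<close> takes its Zariski closure.\<close>

definition universal_variety :: "(complex, 'm::finite) tensor3 set"
  where "universal_variety =
    zariski_closed hull {exp_deg3 P Q L | P Q L. transpose Q = - Q \<and> L \<in> Lie3}"

definition complexify :: "real ^ 'n \<Rightarrow> complex ^ 'n"
  where "complexify x = (\<chi> i. complex_of_real (x $ i))"

end

theory Submission
  imports Defs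
begin

text \<open>
  Suppose that \<open>X\<close> stabilizes a point \<open>C\<close> of the universal variety. Its symmetrization is \<open>P\<close> cubed,
  so \<open>X\<close> maps \<open>P\<close> to \<open>\<eta> P\<close> with \<open>\<eta> ^ 3 = 1\<close>, and we may replace \<open>X\<close> by \<open>X / \<eta>\<close>. Then \<open>X\<close> also fixes
  \<open>PQ + QP = C - reversal C\<close>, hence \<open>Q\<close>, hence the bilinear form \<open>N = Q + PP\<^sup>T\<close>, which for generic \<open>Q\<close>
  is invertible whatever the parity of \<open>m\<close>. The dual form \<open>R\<close> inverse to \<open>N\<close> turns fixed vectors into fixed
  covectors, which can be contracted with \<open>C\<close> to give further fixed vectors. If \<open>m\<close> of these are
  linearly independent then \<open>X = 1\<close>. With \<open>P\<close>, \<open>Q\<close> expressed through \<open>C\<close> up to scalars and \<open>R\<close> replaced by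
  the adjugate, independence is the nonvanishing of a polynomial in the entries of \<open>C\<close>, so it
  remains to exhibit one point at which it holds. There \<open>R\<close> is tridiagonal, and the covectors
  attached to the fixed vectors form a triangular matrix.
\<close>

subsection \<open>Polynomial functions and Zariski closed sets\<close>

lemma poly_fun_uminus: "poly_fun f \<Longrightarrow> poly_fun (\<lambda>x. - f x)"
  using poly_fun.mult[OF poly_fun.const[of "-1"], of f] by simp

lemma poly_fun_diff: "poly_fun f \<Longrightarrow> poly_fun g \<Longrightarrow> poly_fun (\<lambda>x. f x - g x)"
  using poly_fun.add[OF _ poly_fun_uminus, of f g] by simp

lemma poly_fun_sum: "(\<And>i. i \<in> I \<Longrightarrow> poly_fun (f i)) \<Longrightarrow> poly_fun (\<lambda>x. \<Sum>i\<in>I. f i x)"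
  by (induction I rule: infinite_finite_induct) (simp_all add: poly_fun.intros)

lemma poly_fun_prod: "(\<And>i. i \<in> I \<Longrightarrow> poly_fun (f i)) \<Longrightarrow> poly_fun (\<lambda>x. \<Prod>i\<in>I. f i x)"
  by (induction I rule: infinite_finite_induct) (simp_all add: poly_fun.intros)

lemma poly_fun_if: "poly_fun f \<Longrightarrow> poly_fun g \<Longrightarrow> poly_fun (\<lambda>x. if b then f x else g x)"
  by (cases b) simp_all

lemma poly_fun_power: "poly_fun f \<Longrightarrow> poly_fun (\<lambda>x. f x ^ n)"
  by (induction n) (simp_all add: poly_fun.intros)

lemmas poly_fun_intros = poly_fun.intros poly_fun_uminus poly_fun_diff poly_fun_sum poly_fun_prod
  poly_fun_if poly_fun_power

lemma poly_fun_det: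
  fixes A :: "complex ^ 'n \<Rightarrow> complex ^ 'k ^ 'k"
  assumes "\<And>i j. poly_fun (\<lambda>x. A x $ i $ j)"
  shows "poly_fun (\<lambda>x. det (A x))"
  unfolding det_def by (intro poly_fun.mult poly_fun.const poly_fun_sum poly_fun_prod assms)

text \<open>This makes \<open>hull_in\<close> applicable, so that the Zariski closure is itself
  closed. The intersection is cut out by all polynomials that vanish on at least one member of the
  family.\<close>

lemma zariski_closed_Inter:
  assumes "\<And>S. S \<in> \<S> \<Longrightarrow> zariski_closed S"
  shows "zariski_closed (\<Inter>\<S>)"
proof -
  define F where "F = {f. poly_fun f \<and> (\<exists>S\<in>\<S>. \<forall>x\<in>S. f x = 0)}"
  have "x \<in> \<Inter>\<S>" if x: "\<forall>f\<in>F. f x = 0" for x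
  proof
    fix S assume S: "S \<in> \<S>"
    obtain G where G: "\<forall>f\<in>G. poly_fun f" "S = {x. \<forall>f\<in>G. f x = 0}"
      using assms[OF S] unfolding zariski_closed_def by blast
    have "f \<in> F" if "f \<in> G" for f
    proof -
      have "\<forall>x\<in>S. f x = 0"
        using that by (simp add: G(2))
      then show ?thesis
        using G(1) that S by (auto simp: F_def)
    qed
    then show "x \<in> S"
      using x by (simp add: G(2))
  qed
  then have "\<Inter>\<S> = {x. \<forall>f\<in>F. f x = 0}"
    by (auto simp: F_def)
  then show ?thesis
    unfolding zariski_closed_def by (intro exI[of _ F]) (simp add: F_def)
qed

lemma zariski_closed_zero_set: "poly_fun f \<Longrightarrow> zariski_closed {x. f x = 0}"
  unfolding zariski_closed_def by (intro exI[of _ "{f}"]) auto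

lemma zariski_closed_Int: "zariski_closed S \<Longrightarrow> zariski_closed T \<Longrightarrow> zariski_closed (S \<inter> T)"
  using zariski_closed_Inter[of "{S, T}"] by auto

lemma zariski_closed_hull: "zariski_closed (zariski_closed hull S)"
  by (simp add: hull_in zariski_closed_Inter)

text \<open>The locus where \<open>f\<close> and \<open>g\<close> agree is closed, so by minimality
  it contains the hull as soon as it contains \<open>S\<close>.\<close>

lemma poly_fun_eq_on_hull:
  assumes "poly_fun f" "poly_fun g" "\<And>x. x \<in> S \<Longrightarrow> f x = g x" "x \<in> zariski_closed hull S"
  shows "f x = g x"
proof -
  have "zariski_closed hull S \<subseteq> {x. f x - g x = 0}"
    using assms by (intro hull_minimal zariski_closed_zero_set poly_fun_diff) auto
  then show ?thesis using assms(4) by auto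
qed

subsection \<open>The congruence action\<close>

lemma congruence_add: "congruence (C + D) X = congruence C X + congruence D X"
  by (simp add: congruence_def vec_eq_iff sum.distrib algebra_simps)

lemma congruence_diff: "congruence (C - D) X = congruence C X - congruence D X"
  by (simp add: congruence_def vec_eq_iff sum_subtractf algebra_simps)

lemma congruence_scale: "congruence (c *s C) X = c *s congruence C X"
  by (simp add: congruence_def vec_eq_iff sum_distrib_left algebra_simps)

lemma sandwich_nth:
  fixes M :: "'a::comm_ring_1 ^ 'm ^ 'm"
  shows "(X ** M ** transpose X) $ \<beta> $ \<gamma> = (\<Sum>j\<in>UNIV. \<Sum>k\<in>UNIV. M $ j $ k * X $ \<beta> $ j * X $ \<gamma> $ k)"
  unfolding matrix_matrix_mult_def transpose_def
  by (simp add: sum_distrib_right, subst sum.swap) (simp add: mult_ac)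

lemma congruence_tensor_vm:
  "congruence (tensor_vm a M) X = tensor_vm (X *v a) (X ** M ** transpose X)"
  by (simp add: congruence_def tensor_vm_def vec_eq_iff split_paired_all sandwich_nth)
    (simp only: matrix_vector_mult_def vec_lambda_beta sum_distrib_right, simp add: sum_distrib_left mult_ac)

lemma congruence_tensor_mv:
  "congruence (tensor_mv M a) X = tensor_mv (X ** M ** transpose X) (X *v a)"
  by (simp add: congruence_def tensor_mv_def vec_eq_iff split_paired_all sandwich_nth)
    (simp only: matrix_vector_mult_def vec_lambda_beta sum_distrib_right, simp add: sum_distrib_left mult_ac)

section \<open>Permutations of the tensor slots\<close>

definition swap12 :: "('a, 'm::finite) tensor3 \<Rightarrow> ('a, 'm) tensor3"
  where "swap12 C = (\<chi> t. case t of (i, j, k) \<Rightarrow> C $ (j, i, k))"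

definition swap23 :: "('a, 'm::finite) tensor3 \<Rightarrow> ('a, 'm) tensor3"
  where "swap23 C = (\<chi> t. case t of (i, j, k) \<Rightarrow> C $ (i, k, j))"

lemma congruence_swap12: "congruence (swap12 C) X = swap12 (congruence C X)"
  unfolding congruence_def swap12_def
  by (simp add: vec_eq_iff, subst sum.swap) (simp add: mult_ac)

lemma congruence_swap23: "congruence (swap23 C) X = swap23 (congruence C X)"
  unfolding congruence_def swap23_def
  by (simp add: vec_eq_iff, subst (2) sum.swap) (simp add: mult_ac)

text \<open>Adjacent transpositions generate all permutations of the slots. Expressing the reversal
  and the symmetrization through them reduces equivariance under congruence to two exchanges of
  sums.\<close>

definition reversal :: "('a, 'm::finite) tensor3 \<Rightarrow> ('a, 'm) tensor3"
  where "reversal C = swap12 (swap23 (swap12 C))"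

definition symmetrization :: "('a::comm_ring_1, 'm::finite) tensor3 \<Rightarrow> ('a, 'm) tensor3"
  where "symmetrization C = C + swap12 C + swap23 C + swap12 (swap23 C) + swap23 (swap12 C) + reversal C"

lemma congruence_reversal: "congruence (reversal C) X = reversal (congruence C X)"
  by (simp add: reversal_def congruence_swap12 congruence_swap23)

lemma congruence_symmetrization: "congruence (symmetrization C) X = symmetrization (congruence C X)"
  by (simp add: symmetrization_def congruence_add congruence_reversal congruence_swap12 congruence_swap23)

lemma reversal_nth [simp]: "reversal C $ (i, j, k) = C $ (k, j, i)"
  by (simp add: reversal_def swap12_def swap23_def)

lemma symmetrization_nth:
  "symmetrization C $ (i, j, k) = C $ (i, j, k) + C $ (j, i, k) + C $ (i, k, j)
    + C $ (j, k, i) + C $ (k, i, j) + C $ (k, j, i)"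
  by (simp add: symmetrization_def swap12_def swap23_def)

lemma reversal_linear:
  fixes C D :: "('a::comm_ring_1, 'm::finite) tensor3"
  shows "reversal 0 = (0 :: ('a, 'm) tensor3)"
  "reversal (C + D) = reversal C + reversal D"
  "reversal (c *s C) = c *s reversal C"
  by (simp_all add: vec_eq_iff)

lemma symmetrization_linear:
  fixes C D :: "('a::comm_ring_1, 'm::finite) tensor3"
  shows "symmetrization 0 = (0 :: ('a, 'm) tensor3)"
  "symmetrization (C + D) = symmetrization C + symmetrization D"
  "symmetrization (c *s C) = c *s symmetrization C"
  by (simp_all add: vec_eq_iff symmetrization_nth algebra_simps)

lemma bracket_vm_bracket_vv_nth:
  "bracket_vm a (bracket_vv b c) $ (i, j, k)
    = a $ i * (b $ j * c $ k - c $ j * b $ k) - (b $ i * c $ j - c $ i * b $ j) * a $ k"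
  by (simp add: bracket_vm_def bracket_vv_def tensor_vm_def tensor_mv_def tensor_vv_def)

text \<open>Both conditions are linear, so generators suffice. Reversal is an anti-automorphism of
  the tensor algebra, hence negates each commutator of reversal-eigenvectors up to their signs, and
  the two signs of a double commutator cancel. Symmetrization kills commutators.\<close>

lemma Lie3_symmetries:
  fixes L :: "('a::field, 'm::finite) tensor3"
  assumes "L \<in> Lie3"
  shows "reversal L = L" "symmetrization L = 0"
proof -
  let ?S = "{L :: ('a, 'm) tensor3. reversal L = L \<and> symmetrization L = 0}"
  have "Lie3 \<subseteq> ?S"
    unfolding Lie3_def
  proof (rule vec.span_minimal)
    show "vec.subspace ?S"
      by (rule vec.subspaceI) (simp_all add: reversal_linear symmetrization_linear)
    have "bracket_vm a (bracket_vv b c) \<in> ?S" for a b c :: "'a ^ 'm"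
      by (simp add: vec_eq_iff symmetrization_nth bracket_vm_bracket_vv_nth algebra_simps)
    then show "{bracket_vm a (bracket_vv b c) |a b c. True} \<subseteq> ?S"
      by blast
  qed
  then show "reversal L = L" "symmetrization L = 0"
    using assms by auto
qed

subsection \<open>Recovering P and Q up to scalars\<close>

text \<open>On the parametrized set this is \<open>(P $ i0)\<^sup>2 *s P\<close>. Fixing two slots
  at \<open>i0\<close> keeps the recovery of \<open>P\<close> polynomial in \<open>C\<close>; no
  cube root is taken.\<close>

definition vecP :: "'m \<Rightarrow> ('a::comm_ring_1, 'm::finite) tensor3 \<Rightarrow> 'a ^ 'm"
  where "vecP i0 C = (\<chi> j. symmetrization C $ (i0, i0, j))"

text \<open>On the parametrized set \<open>C - reversal C\<close> is \<open>PQ + QP\<close>; the formula solves this for \<open>Q\<close>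
  up to the factor \<open>(P $ i0) ^ 4\<close>.\<close>
definition matQ :: "'m \<Rightarrow> ('a::comm_ring_1, 'm::finite) tensor3 \<Rightarrow> 'a ^ 'm ^ 'm"
  where "matQ i0 C = (let T = C - reversal C in
    (\<chi> j k. vecP i0 C $ i0 * (T $ (i0, j, k) + T $ (j, i0, k)) - vecP i0 C $ j * T $ (i0, i0, k)))"

lemma skew_nth: "Q $ i $ j = - Q $ j $ i" if "transpose Q = - Q"
  using arg_cong[OF that, of "\<lambda>M. M $ j $ i"] by (simp add: transpose_def)

text \<open>The six permutations cancel the coefficient 1/6 of the cube. The mixed terms vanish
  because \<open>Q\<close> is skew, and \<open>L\<close> vanishes by
  \<open>Lie3_symmetries\<close>.\<close>

lemma symmetrization_exp_deg3:
  fixes P :: "'a::field_char_0 ^ 'm::finite"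
  assumes "transpose Q = - Q" "L \<in> Lie3"
  shows "symmetrization (exp_deg3 P Q L) = tensor_vm P (tensor_vv P P)"
proof -
  have Q: "Q $ i $ j = - Q $ j $ i" for i j
    by (rule skew_nth[OF assms(1)])
  have "symmetrization (tensor_vm P Q + tensor_mv Q P) $ (i, j, k) = 0" for i j k
    by (simp add: symmetrization_nth tensor_vm_def tensor_mv_def Q[of j i] Q[of k i] Q[of k j] algebra_simps)
  then have 1: "symmetrization (tensor_vm P Q + tensor_mv Q P) = 0"
    by (simp add: vec_eq_iff)
  have 2: "symmetrization (tensor_vm P (tensor_vv P P)) = 6 *s tensor_vm P (tensor_vv P P)"
    by (simp add: vec_eq_iff symmetrization_nth tensor_vm_def tensor_vv_def)
  show ?thesis
    unfolding exp_deg3_def symmetrization_linear(2)[of _ L] symmetrization_linear(2)[of "_ *s _"]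
      symmetrization_linear(3) 1 2 Lie3_symmetries(2)[OF assms(2)]
    by (simp add: vec_eq_iff)
qed

text \<open>Reversal fixes the cube of \<open>P\<close> and the Lie part but negates PQ + QP, so the
  difference doubles the latter and cancels its coefficient 1/2.\<close>

lemma antireversal_exp_deg3:
  fixes P :: "'a::field_char_0 ^ 'm::finite"
  assumes "transpose Q = - Q" "L \<in> Lie3"
  shows "exp_deg3 P Q L - reversal (exp_deg3 P Q L) = tensor_vm P Q + tensor_mv Q P"
proof -
  have Q: "Q $ i $ j = - Q $ j $ i" for i j
    by (rule skew_nth[OF assms(1)])
  have "reversal (tensor_vm P Q + tensor_mv Q P) $ (i, j, k) = (- (tensor_vm P Q + tensor_mv Q P)) $ (i, j, k)" for i j k
    by (simp add: tensor_vm_def tensor_mv_def Q[of j i] Q[of k j])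
  then have 1: "reversal (tensor_vm P Q + tensor_mv Q P) = - (tensor_vm P Q + tensor_mv Q P)"
    by (simp add: vec_eq_iff)
  have 2: "reversal (tensor_vm P (tensor_vv P P)) = tensor_vm P (tensor_vv P P)"
    by (simp add: vec_eq_iff tensor_vm_def tensor_vv_def)
  show ?thesis
    unfolding exp_deg3_def reversal_linear(2)[of _ L] reversal_linear(2)[of "_ *s _"]
      reversal_linear(3) 1 2 Lie3_symmetries(1)[OF assms(2)]
    by (simp add: vec_eq_iff field_simps)
qed

lemma vecP_exp_deg3:
  fixes P :: "'a::field_char_0 ^ 'm::finite"
  assumes "transpose Q = - Q" "L \<in> Lie3"
  shows "vecP i0 (exp_deg3 P Q L) = (P $ i0)\<^sup>2 *s P"
  by (simp add: vecP_def symmetrization_exp_deg3[OF assms] vec_eq_iff tensor_vm_def tensor_vv_def power2_eq_square)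

text \<open>In \<open>T $ (i0, j, k) + T $ (j, i0, k)\<close> the two terms with factor
  \<open>P $ k\<close> cancel by skewness. The remaining unwanted term contains
  \<open>P $ j * Q $ i0 $ k\<close>; it is removed through \<open>T $ (i0, i0, k)\<close>, where
  \<open>Q $ i0 $ i0 = 0\<close>.\<close>

lemma matQ_exp_deg3:
  fixes P :: "'a::field_char_0 ^ 'm::finite"
  assumes "transpose Q = - Q" "L \<in> Lie3"
  shows "matQ i0 (exp_deg3 P Q L) $ j $ k = (P $ i0) ^ 4 * Q $ j $ k"
proof -
  have Q: "Q $ i $ j = - Q $ j $ i" for i j
    by (rule skew_nth[OF assms(1)])
  have Q0: "Q $ i0 $ i0 = 0"
    using Q[of i0 i0] by (simp add: eq_neg_iff_add_eq_0 flip: mult_2)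
  show ?thesis
    by (simp add: matQ_def Let_def antireversal_exp_deg3[OF assms] vecP_exp_deg3[OF assms] Q0 Q[of j i0]
        tensor_vm_def tensor_mv_def power4_eq_xxxx power2_eq_square algebra_simps)
qed

subsection \<open>Vectors fixed by the stabilizer\<close>

definition adjugate :: "'a::comm_ring_1 ^ 'm ^ 'm \<Rightarrow> 'a ^ 'm ^ 'm"
  where "adjugate A = (\<chi> k i. det (\<chi> r j. if j = k then (if r = i then 1 else 0) else A $ r $ j))"

text \<open>The entries of \<open>adjugate\<close> are the numerators in Cramer's rule for the
  systems whose right-hand sides are the unit vectors.\<close>

lemma mult_adjugate:
  fixes A :: "'a::field ^ 'm::finite ^ 'm"
  assumes "det A \<noteq> 0"
  shows "A ** adjugate A = mat (det A)"
proof -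
  have "A *v (\<chi> k. adjugate A $ k $ i / det A) = axis i 1" for i
    unfolding cramer[OF assms] by (simp add: adjugate_def vec_eq_iff axis_def eq_commute cong: if_cong)
  then have "(\<Sum>k\<in>UNIV. A $ j $ k * (adjugate A $ k $ i / det A)) = (if j = i then 1 else 0)" for i j
    by (simp add: matrix_vector_mult_def vec_eq_iff axis_def)
  then have "(\<Sum>k\<in>UNIV. A $ j $ k * adjugate A $ k $ i) / det A = (if j = i then 1 else 0)" for i j
    by (simp add: sum_divide_distrib)
  then show ?thesis
    using assms by (simp add: matrix_matrix_mult_def mat_def vec_eq_iff divide_eq_eq)
qed

lemma mat_mult_commute: "mat c ** B = B ** mat c" for B :: "'a::comm_ring_1 ^ 'm::finite ^ 'm"
  by (simp add: matrix_matrix_mult_def mat_def vec_eq_iff if_distrib[of "\<lambda>x. x * _"]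
      if_distrib[of "\<lambda>x. _ * x"] mult.commute cong: if_cong)

lemma adjugate_mult:
  fixes A :: "'a::field ^ 'm::finite ^ 'm"
  assumes "det A \<noteq> 0"
  shows "adjugate A ** A = mat (det A)"
proof -
  obtain B where B: "B ** A = mat 1"
    using assms by (meson invertible_det_nz invertible_def)
  have "adjugate A = B ** (A ** adjugate A)"
    by (simp add: matrix_mul_assoc B)
  also have "\<dots> = mat (det A) ** B"
    by (simp add: mult_adjugate[OF assms] mat_mult_commute)
  finally show ?thesis
    by (metis B matrix_mul_assoc matrix_mul_rid)
qed

text \<open>Up to the factor \<open>det N\<close> the adjugate is the inverse form, so the claim is
  the inverted invariance of \<open>N\<close>. Taking determinants in that invariance shows that
  \<open>X\<close> can be cancelled.\<close>

lemma adjugate_invariant: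
  fixes N X :: "'a::field ^ 'm::finite ^ 'm"
  assumes "det N \<noteq> 0" "X ** N ** transpose X = N"
  shows "transpose X ** adjugate N ** X = adjugate N"
proof -
  let ?R = "adjugate N"
  have cancel: "A ** B = A ** C \<Longrightarrow> B = C" if "det A \<noteq> 0" for A B C :: "'a ^ 'm ^ 'm"
    using that by (metis invertible_det_nz invertible_def matrix_mul_assoc matrix_mul_lid)
  have X: "det X \<noteq> 0"
    using assms by (metis det_mul mult_eq_0_iff)
  have "X ** (N ** (transpose X ** ?R ** X)) = (X ** N ** transpose X) ** ?R ** X"
    by (simp add: matrix_mul_assoc)
  also have "\<dots> = X ** (N ** ?R)"
    by (simp add: assms mult_adjugate mat_mult_commute)
  finally show ?thesis
    using cancel[OF X] cancel[OF assms(1)] by blast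
qed

text \<open>On the parametrized set both summands carry the factor \<open>(P $ i0) ^ 4\<close>, so
  this is a multiple of Q + PP^T.\<close>

definition formN :: "'m \<Rightarrow> ('a::comm_ring_1, 'm::finite) tensor3 \<Rightarrow> 'a ^ 'm ^ 'm"
  where "formN i0 C = matQ i0 C + tensor_vv (vecP i0 C) (vecP i0 C)"

definition contr :: "('a::comm_ring_1, 'm::finite) tensor3 \<Rightarrow> 'a ^ 'm \<Rightarrow> 'a ^ 'm \<Rightarrow> 'a ^ 'm"
  where "contr C y z = (\<chi> i. \<Sum>j\<in>UNIV. \<Sum>k\<in>UNIV. C $ (i, j, k) * y $ j * z $ k)"

definition contr_form :: "('a::comm_ring_1, 'm::finite) tensor3 \<Rightarrow> 'a ^ 'm ^ 'm \<Rightarrow> 'a ^ 'm"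
  where "contr_form C R = (\<chi> i. \<Sum>j\<in>UNIV. \<Sum>k\<in>UNIV. C $ (i, j, k) * R $ j $ k)"

text \<open>From index 1 on, one linear map is iterated: a vector is turned into a covector by the
  dual form and inserted into the third slot of \<open>C\<close>, the second slot being filled with
  the covector of P. The iteration starts from the full contraction of \<open>C\<close> with the
  dual form.\<close>

fun frame_vector :: "'m \<Rightarrow> ('a::comm_ring_1, 'm::finite) tensor3 \<Rightarrow> nat \<Rightarrow> 'a ^ 'm"
  where
    "frame_vector i0 C 0 = vecP i0 C"
  | "frame_vector i0 C (Suc 0) = contr_form C (adjugate (formN i0 C))"
  | "frame_vector i0 C (Suc (Suc n)) = contr C (adjugate (formN i0 C) *v vecP i0 C)
       (adjugate (formN i0 C) *v frame_vector i0 C (Suc n))"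

section \<open>Equivariance of the contractions\<close>

definition act1 :: "'a::comm_ring_1 ^ 'm ^ 'm \<Rightarrow> ('a, 'm::finite) tensor3 \<Rightarrow> ('a, 'm) tensor3"
  where "act1 X C = (\<chi> t. case t of (i, j, k) \<Rightarrow> \<Sum>a\<in>UNIV. C $ (a, j, k) * X $ i $ a)"

definition act2 :: "'a::comm_ring_1 ^ 'm ^ 'm \<Rightarrow> ('a, 'm::finite) tensor3 \<Rightarrow> ('a, 'm) tensor3"
  where "act2 X C = (\<chi> t. case t of (i, j, k) \<Rightarrow> \<Sum>b\<in>UNIV. C $ (i, b, k) * X $ j $ b)"

definition act3 :: "'a::comm_ring_1 ^ 'm ^ 'm \<Rightarrow> ('a, 'm::finite) tensor3 \<Rightarrow> ('a, 'm) tensor3"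
  where "act3 X C = (\<chi> t. case t of (i, j, k) \<Rightarrow> \<Sum>c\<in>UNIV. C $ (i, j, c) * X $ k $ c)"

text \<open>Splitting the action into its three slots means that each contraction lemma has to move
  only one sum.\<close>

lemma congruence_eq_act: "congruence C X = act1 X (act2 X (act3 X C))"
  by (simp add: vec_eq_iff congruence_def act1_def act2_def act3_def sum_distrib_left sum_distrib_right mult_ac)

lemma sum_swap23:
  "(\<Sum>i\<in>A. \<Sum>j\<in>B. \<Sum>k\<in>C. f i j k) = (\<Sum>i\<in>A. \<Sum>k\<in>C. \<Sum>j\<in>B. f i j k)"
  by (intro sum.cong refl sum.swap)

lemma sum_swap13:
  "(\<Sum>i\<in>A. \<Sum>j\<in>B. \<Sum>k\<in>C. f i j k) = (\<Sum>k\<in>C. \<Sum>j\<in>B. \<Sum>i\<in>A. f i j k)"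
  by (rule trans[OF sum_swap23 trans[OF sum.swap sum_swap23]])

lemma contr_act1: "contr (act1 X C) y z = X *v contr C y z"
proof -
  have "(\<Sum>j\<in>UNIV. \<Sum>k\<in>UNIV. (\<Sum>a\<in>UNIV. C $ (a, j, k) * X $ i $ a) * y $ j * z $ k)
    = (\<Sum>j\<in>UNIV. \<Sum>k\<in>UNIV. \<Sum>a\<in>UNIV. C $ (a, j, k) * X $ i $ a * y $ j * z $ k)" for i
    by (simp add: sum_distrib_right)
  also have "\<dots> i = (\<Sum>a\<in>UNIV. \<Sum>j\<in>UNIV. \<Sum>k\<in>UNIV. C $ (a, j, k) * X $ i $ a * y $ j * z $ k)" for i
    by (subst sum_swap13, rule sum_swap23)
  finally show ?thesis
    by (simp add: vec_eq_iff contr_def act1_def matrix_vector_mult_def sum_distrib_left mult_ac)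
qed

lemma contr_act2: "contr (act2 X C) y z = contr C (transpose X *v y) z"
proof -
  have "(\<Sum>j\<in>UNIV. \<Sum>k\<in>UNIV. (\<Sum>a\<in>UNIV. C $ (i, a, k) * X $ j $ a) * y $ j * z $ k)
    = (\<Sum>j\<in>UNIV. \<Sum>k\<in>UNIV. \<Sum>a\<in>UNIV. C $ (i, a, k) * X $ j $ a * y $ j * z $ k)" for i
    by (simp add: sum_distrib_right)
  also have "\<dots> i = (\<Sum>a\<in>UNIV. \<Sum>k\<in>UNIV. \<Sum>j\<in>UNIV. C $ (i, a, k) * X $ j $ a * y $ j * z $ k)" for i
    by (rule sum_swap13)
  finally show ?thesis
    by (simp add: vec_eq_iff contr_def act2_def matrix_vector_mult_def transpose_def sum_distrib_left
        sum_distrib_right mult_ac)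
qed

lemma contr_act3: "contr (act3 X C) y z = contr C y (transpose X *v z)"
proof -
  have "(\<Sum>j\<in>UNIV. \<Sum>k\<in>UNIV. (\<Sum>a\<in>UNIV. C $ (i, j, a) * X $ k $ a) * y $ j * z $ k)
    = (\<Sum>j\<in>UNIV. \<Sum>k\<in>UNIV. \<Sum>a\<in>UNIV. C $ (i, j, a) * X $ k $ a * y $ j * z $ k)" for i
    by (simp add: sum_distrib_right)
  also have "\<dots> i = (\<Sum>j\<in>UNIV. \<Sum>a\<in>UNIV. \<Sum>k\<in>UNIV. C $ (i, j, a) * X $ k $ a * y $ j * z $ k)" for i
    by (rule sum_swap23)
  finally show ?thesis
    by (simp add: vec_eq_iff contr_def act3_def matrix_vector_mult_def transpose_def sum_distrib_left
        sum_distrib_right mult_ac)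
qed

lemma contr_form_act1: "contr_form (act1 X C) R = X *v contr_form C R"
proof -
  have "(\<Sum>j\<in>UNIV. \<Sum>k\<in>UNIV. (\<Sum>a\<in>UNIV. C $ (a, j, k) * X $ i $ a) * R $ j $ k)
    = (\<Sum>j\<in>UNIV. \<Sum>k\<in>UNIV. \<Sum>a\<in>UNIV. C $ (a, j, k) * X $ i $ a * R $ j $ k)" for i
    by (simp add: sum_distrib_right)
  also have "\<dots> i = (\<Sum>a\<in>UNIV. \<Sum>j\<in>UNIV. \<Sum>k\<in>UNIV. C $ (a, j, k) * X $ i $ a * R $ j $ k)" for i
    by (subst sum_swap13, rule sum_swap23)
  finally show ?thesis
    by (simp add: vec_eq_iff contr_form_def act1_def matrix_vector_mult_def sum_distrib_left mult_ac)
qed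

lemma contr_form_act2: "contr_form (act2 X C) R = contr_form C (transpose X ** R)"
proof -
  have "(\<Sum>j\<in>UNIV. \<Sum>k\<in>UNIV. (\<Sum>a\<in>UNIV. C $ (i, a, k) * X $ j $ a) * R $ j $ k)
    = (\<Sum>j\<in>UNIV. \<Sum>k\<in>UNIV. \<Sum>a\<in>UNIV. C $ (i, a, k) * X $ j $ a * R $ j $ k)" for i
    by (simp add: sum_distrib_right)
  also have "\<dots> i = (\<Sum>a\<in>UNIV. \<Sum>k\<in>UNIV. \<Sum>j\<in>UNIV. C $ (i, a, k) * X $ j $ a * R $ j $ k)" for i
    by (rule sum_swap13)
  finally show ?thesis
    by (simp add: vec_eq_iff contr_form_def act2_def matrix_matrix_mult_def transpose_def sum_distrib_left mult_ac)
qed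

lemma contr_form_act3: "contr_form (act3 X C) R = contr_form C (R ** X)"
proof -
  have "(\<Sum>j\<in>UNIV. \<Sum>k\<in>UNIV. (\<Sum>a\<in>UNIV. C $ (i, j, a) * X $ k $ a) * R $ j $ k)
    = (\<Sum>j\<in>UNIV. \<Sum>k\<in>UNIV. \<Sum>a\<in>UNIV. C $ (i, j, a) * X $ k $ a * R $ j $ k)" for i
    by (simp add: sum_distrib_right)
  also have "\<dots> i = (\<Sum>j\<in>UNIV. \<Sum>a\<in>UNIV. \<Sum>k\<in>UNIV. C $ (i, j, a) * X $ k $ a * R $ j $ k)" for i
    by (rule sum_swap23)
  finally show ?thesis
    by (simp add: vec_eq_iff contr_form_def act3_def matrix_matrix_mult_def sum_distrib_left mult_ac)
qed

lemma contr_congruence: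
  "contr (congruence C X) y z = X *v contr C (transpose X *v y) (transpose X *v z)"
  by (simp add: congruence_eq_act contr_act1 contr_act2 contr_act3)

lemma contr_form_congruence:
  "contr_form (congruence C X) R = X *v contr_form C (transpose X ** R ** X)"
  by (simp add: congruence_eq_act contr_form_act1 contr_form_act2 contr_form_act3)

lemma frame_vector_fixed:
  fixes C :: "('a::field, 'm::finite) tensor3"
  assumes C: "congruence C X = C" and P: "X *v vecP i0 C = vecP i0 C"
    and N: "X ** formN i0 C ** transpose X = formN i0 C" "det (formN i0 C) \<noteq> 0"
  shows "X *v frame_vector i0 C n = frame_vector i0 C n"
proof -
  let ?R = "adjugate (formN i0 C)"
  have R: "transpose X ** ?R ** X = ?R"
    by (rule adjugate_invariant[OF N(2,1)])
  \<comment> \<open>Invariance of the dual form turns a vector fixed by \<open>X\<close> into a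
    covector fixed by \<open>transpose X\<close>.\<close>
  have dual: "transpose X *v (?R *v w) = ?R *v w" if "X *v w = w" for w
    by (metis R matrix_vector_mul_assoc that)
  show ?thesis
  proof (induction n rule: induct_nat_012)
    case 0
    then show ?case using P by simp
  next
    case 1
    then show ?case
      using contr_form_congruence[of C X ?R] by (simp add: C R)
  next
    case (ge2 n)
    show ?case
      using contr_congruence[of C X "?R *v vecP i0 C" "?R *v frame_vector i0 C (Suc n)"]
      unfolding frame_vector.simps C dual[OF P] dual[OF ge2(2)] by (rule sym)
  qed
qed

section \<open>Polynomial identities on the Zariski closure\<close>

lemma poly_fun_symmetrization: "poly_fun (\<lambda>C. symmetrization C $ (i, j, k))"
  unfolding symmetrization_nth by (intro poly_fun_intros)

lemma poly_fun_vecP: "poly_fun (\<lambda>C. vecP i0 C $ j)"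
  by (simp add: vecP_def poly_fun_symmetrization)

lemma poly_fun_matQ: "poly_fun (\<lambda>C. matQ i0 C $ j $ k)"
  by (simp add: matQ_def Let_def) (intro poly_fun_intros poly_fun_vecP)

text \<open>A point of the closure need not have the form \<open>exp_deg3 P Q L\<close>. What is
  known about \<open>P\<close> and \<open>Q\<close> is therefore restated as identities between
  \<open>vecP\<close>, \<open>matQ\<close> and \<open>C\<close>, with the powers of
  \<open>P $ i0\<close> balanced on both sides.\<close>

lemma universal_variety_eqI:
  fixes f g :: "complex ^ ('m::finite \<times> 'm \<times> 'm) \<Rightarrow> complex"
  assumes "poly_fun f" "poly_fun g"
    and "\<And>P Q L. transpose Q = - Q \<Longrightarrow> L \<in> Lie3 \<Longrightarrow> f (exp_deg3 P Q L) = g (exp_deg3 P Q L)"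
    and "C \<in> universal_variety"
  shows "f C = g C"
  using assms(1,2) _ assms(4)[unfolded universal_variety_def]
  by (rule poly_fun_eq_on_hull) (use assms(3) in auto)

lemma universal_variety_symmetrization:
  fixes C :: "(complex, 'm::finite) tensor3"
  assumes "C \<in> universal_variety"
  shows "tensor_vm (vecP i0 C) (tensor_vv (vecP i0 C) (vecP i0 C)) = (vecP i0 C $ i0)\<^sup>2 *s symmetrization C"
proof -
  have "vecP i0 C $ a * (vecP i0 C $ b * vecP i0 C $ c) = (vecP i0 C $ i0)\<^sup>2 * symmetrization C $ (a, b, c)"
    for a b c
    by (rule universal_variety_eqI[OF _ _ _ assms])
      (intro poly_fun_intros poly_fun_vecP poly_fun_symmetrization,
       intro poly_fun_intros poly_fun_vecP poly_fun_symmetrization,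
       simp add: vecP_exp_deg3 symmetrization_exp_deg3 tensor_vm_def tensor_vv_def power2_eq_square)
  then show ?thesis
    by (simp add: vec_eq_iff tensor_vm_def tensor_vv_def)
qed

lemma universal_variety_antireversal:
  fixes C :: "(complex, 'm::finite) tensor3"
  assumes "C \<in> universal_variety"
  shows "tensor_vm (vecP i0 C) (matQ i0 C) + tensor_mv (matQ i0 C) (vecP i0 C)
    = (vecP i0 C $ i0)\<^sup>2 *s (C - reversal C)"
proof -
  have "vecP i0 C $ a * matQ i0 C $ b $ c + matQ i0 C $ a $ b * vecP i0 C $ c
      = (vecP i0 C $ i0)\<^sup>2 * (C $ (a, b, c) - reversal C $ (a, b, c))" for a b c
    unfolding reversal_nth
  proof (rule universal_variety_eqI[OF _ _ _ assms])
    fix P :: "complex ^ 'm" and Q :: "complex ^ 'm ^ 'm" and L :: "(complex, 'm) tensor3"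
    assume QL: "transpose Q = - Q" "L \<in> Lie3"
    let ?E = "exp_deg3 P Q L"
    have "?E $ (a, b, c) - ?E $ (c, b, a) = P $ a * Q $ b $ c + Q $ a $ b * P $ c"
      using arg_cong[OF antireversal_exp_deg3[OF QL, of P], of "\<lambda>T. T $ (a, b, c)"]
      by (simp add: tensor_vm_def tensor_mv_def)
    then show "vecP i0 ?E $ a * matQ i0 ?E $ b $ c + matQ i0 ?E $ a $ b * vecP i0 ?E $ c
      = (vecP i0 ?E $ i0)\<^sup>2 * (?E $ (a, b, c) - ?E $ (c, b, a))"
      by (simp add: vecP_exp_deg3[OF QL] matQ_exp_deg3[OF QL] power2_eq_square power4_eq_xxxx algebra_simps)
  qed (intro poly_fun_intros poly_fun_vecP poly_fun_matQ)+
  then show ?thesis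
    by (simp add: vec_eq_iff tensor_vm_def tensor_mv_def right_diff_distrib)
qed

lemma universal_variety_matQ_skew:
  fixes C :: "(complex, 'm::finite) tensor3"
  assumes "C \<in> universal_variety"
  shows "transpose (matQ i0 C) = - matQ i0 C"
proof -
  have "matQ i0 C $ k $ j = - matQ i0 C $ j $ k" for j k
  proof (rule universal_variety_eqI[OF _ _ _ assms])
    fix P :: "complex ^ 'm" and Q :: "complex ^ 'm ^ 'm" and L :: "(complex, 'm) tensor3"
    assume QL: "transpose Q = - Q" "L \<in> Lie3"
    show "matQ i0 (exp_deg3 P Q L) $ k $ j = - matQ i0 (exp_deg3 P Q L) $ j $ k"
      by (simp add: matQ_exp_deg3[OF QL] skew_nth[OF QL(1), of k j])
  qed (intro poly_fun_intros poly_fun_matQ)+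
  then show ?thesis
    unfolding vec_eq_iff transpose_def vec_lambda_beta vector_uminus_component by blast
qed

text \<open>The ratio of the \<open>i\<close>-th coordinates is the required root of unity: entry
  (i, i, i) gives its cube, and comparison with the entries (a, i, i) gives proportionality.\<close>

lemma tensor_cube_eqD:
  fixes p u :: "'a::field ^ 'm::finite"
  assumes "tensor_vm u (tensor_vv u u) = tensor_vm p (tensor_vv p p)" "p $ i \<noteq> 0"
  obtains \<eta> where "\<eta> ^ 3 = 1" "u = \<eta> *s p"
proof
  let ?\<eta> = "u $ i / p $ i"
  have eq: "u $ a * (u $ b * u $ c) = p $ a * (p $ b * p $ c)" for a b c
    using arg_cong[OF assms(1), of "\<lambda>T. T $ (a, b, c)"] by (simp add: tensor_vm_def tensor_vv_def)
  show \<eta>: "?\<eta> ^ 3 = 1"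
    using eq[of i i i] assms(2) by (simp add: power_divide power3_eq_cube mult.assoc)
  then have u: "u $ i \<noteq> 0"
    by auto
  have "u $ a = ?\<eta> * p $ a" for a
  proof -
    have "u $ a * (p $ i * (p $ i * p $ i)) = u $ a * (u $ i * u $ i) * u $ i"
      unfolding eq[of i i i, symmetric] by (simp add: mult_ac)
    also have "\<dots> = p $ a * (p $ i * p $ i) * u $ i"
      by (simp add: eq)
    finally show ?thesis
      using assms(2) by (simp add: field_simps)
  qed
  then show "u = ?\<eta> *s p"
    unfolding vec_eq_iff vector_smult_component by blast
qed

text \<open>The difference \<open>D\<close> of the two forms vanishes in stages:
  \<open>D $ i $ i\<close> by skewness, then row \<open>i\<close> by the entries (i, i, b), then
  everything by the entries (i, a, b).\<close>

lemma tensor_skew_eqD: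
  fixes p :: "'a::field_char_0 ^ 'm::finite"
  assumes "tensor_vm p A + tensor_mv A p = tensor_vm p B + tensor_mv B p" "p $ i \<noteq> 0"
    and "transpose A = - A" "transpose B = - B"
  shows "A = B"
proof -
  define D where "D = A - B"
  have eq: "p $ a * D $ b $ c + D $ a $ b * p $ c = 0" for a b c
    using arg_cong[OF assms(1), of "\<lambda>T. T $ (a, b, c)"]
    by (simp add: tensor_vm_def tensor_mv_def D_def algebra_simps)
  have "D $ i $ i = - D $ i $ i"
    using skew_nth[OF assms(3), of i i] skew_nth[OF assms(4), of i i] by (simp add: D_def)
  then have "D $ i $ i = 0"
    by (simp add: eq_neg_iff_add_eq_0 flip: mult_2)
  then have "D $ i $ b = 0" for b
    using eq[of i i b] assms(2) by simp
  then have "D $ a $ b = 0" for a b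
    using eq[of i a b] assms(2) by simp
  then show ?thesis
    by (simp add: D_def vec_eq_iff)
qed

section \<open>The certificate and triviality of the stabilizer\<close>

definition frame :: "'m \<Rightarrow> ('m \<Rightarrow> nat) \<Rightarrow> ('a::comm_ring_1, 'm::finite) tensor3 \<Rightarrow> 'a ^ 'm ^ 'm"
  where "frame i0 g C = (\<chi> i j. frame_vector i0 C (g j) $ i)"

text \<open>The product collects the three open conditions: P can be recovered, the form is
  invertible, and the chosen fixed vectors are independent. A single polynomial then cuts out the
  exceptional set.\<close>

definition certificate :: "'m \<Rightarrow> ('m \<Rightarrow> nat) \<Rightarrow> ('a::comm_ring_1, 'm::finite) tensor3 \<Rightarrow> 'a"
  where "certificate i0 g C = vecP i0 C $ i0 * det (formN i0 C) * det (frame i0 g C)"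

lemma mat_mult_nth: "(mat c ** X) $ i $ j = c * X $ i $ j"
  for X :: "'a::comm_ring_1 ^ 'n::finite ^ 'm::finite"
  by (simp add: matrix_matrix_mult_def mat_def if_distrib[of "\<lambda>x. x * _"] cong: if_cong)

lemma congruence_mat_mult: "congruence C (mat c ** X) = c ^ 3 *s congruence C X"
  by (simp add: congruence_def vec_eq_iff mat_mult_nth sum_distrib_left power3_eq_cube mult_ac)

lemma sandwich_tensor_vv: "Y ** tensor_vv a b ** transpose Y = tensor_vv (Y *v a) (Y *v b)"
  by (simp add: vec_eq_iff sandwich_nth tensor_vv_def matrix_vector_mult_def sum_product mult_ac)

lemma sandwich_add: "Y ** (A + B) ** transpose Y = Y ** A ** transpose Y + Y ** B ** transpose Y"
  for A :: "'a::comm_ring_1 ^ 'm ^ 'm"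
  by (simp add: vec_eq_iff sandwich_nth sum.distrib distrib_right)

lemma congruence_fixed_imp_mat:
  fixes C :: "(complex, 'm::finite) tensor3"
  assumes V: "C \<in> universal_variety" and cert: "certificate i0 g C \<noteq> 0" and X: "congruence C X = C"
  obtains \<eta> where "\<eta> ^ 3 = 1" "X = mat \<eta>"
proof -
  let ?p = "vecP i0 C" and ?q = "matQ i0 C"
  have p: "?p $ i0 \<noteq> 0" and N: "det (formN i0 C) \<noteq> 0" and K: "det (frame i0 g C) \<noteq> 0"
    using cert by (auto simp: certificate_def)
  have "congruence (symmetrization C) X = symmetrization C"
    by (simp add: congruence_symmetrization X)
  then have "congruence (tensor_vm ?p (tensor_vv ?p ?p)) X = tensor_vm ?p (tensor_vv ?p ?p)"
    by (simp add: universal_variety_symmetrization[OF V] congruence_scale)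
  then have "tensor_vm (X *v ?p) (tensor_vv (X *v ?p) (X *v ?p)) = tensor_vm ?p (tensor_vv ?p ?p)"
    by (simp add: congruence_tensor_vm sandwich_tensor_vv)
  then obtain \<eta> where \<eta>: "\<eta> ^ 3 = 1" "X *v ?p = \<eta> *s ?p"
    using tensor_cube_eqD p by blast
  then have \<eta>0: "\<eta> \<noteq> 0"
    by auto
  \<comment> \<open>Since \<open>\<eta> ^ 3 = 1\<close>, dividing by \<eta> does not change the
    action on \<open>C\<close>, and it makes P itself fixed.\<close>
  define Y where "Y = mat (1 / \<eta>) ** X"
  have Y: "congruence C Y = C"
    by (simp add: Y_def congruence_mat_mult X power_one_over \<eta>(1))
  have Yp: "Y *v ?p = ?p"
  proof -
    have "Y *v ?p = (1 / \<eta>) *s (X *v ?p)"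
      by (simp add: Y_def vec_eq_iff matrix_vector_mult_def mat_mult_nth sum_divide_distrib)
    then show ?thesis
      by (simp add: \<eta> \<eta>0 vec_eq_iff)
  qed
  have "congruence (C - reversal C) Y = C - reversal C"
    by (simp add: congruence_diff congruence_reversal Y)
  then have "congruence (tensor_vm ?p ?q + tensor_mv ?q ?p) Y = tensor_vm ?p ?q + tensor_mv ?q ?p"
    by (simp only: universal_variety_antireversal[OF V] congruence_scale)
  then have "tensor_vm ?p (Y ** ?q ** transpose Y) + tensor_mv (Y ** ?q ** transpose Y) ?p
      = tensor_vm ?p ?q + tensor_mv ?q ?p"
    by (simp add: congruence_add congruence_tensor_vm congruence_tensor_mv Yp)
  moreover have skew: "transpose ?q = - ?q"
    by (rule universal_variety_matQ_skew[OF V])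
  \<comment> \<open>Both the form and its transform must be skew before
    \<open>tensor_skew_eqD\<close> can identify them.\<close>
  moreover have "transpose (Y ** ?q ** transpose Y) = - (Y ** ?q ** transpose Y)"
  proof -
    have "Y ** (- ?q) ** transpose Y = - (Y ** ?q ** transpose Y)"
      by (simp add: vec_eq_iff sandwich_nth sum_negf)
    then show ?thesis
      by (simp add: matrix_transpose_mul skew matrix_mul_assoc)
  qed
  ultimately have "Y ** ?q ** transpose Y = ?q"
    using tensor_skew_eqD p by blast
  then have "Y ** formN i0 C ** transpose Y = formN i0 C"
    by (simp add: formN_def sandwich_add sandwich_tensor_vv Yp)
  then have "Y *v frame_vector i0 C n = frame_vector i0 C n" for n
    by (intro frame_vector_fixed Y Yp N)
  then have YK: "Y ** frame i0 g C = frame i0 g C"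
    by (simp add: vec_eq_iff matrix_matrix_mult_def matrix_vector_mult_def frame_def)
  obtain B where "frame i0 g C ** B = mat 1"
    using K by (meson invertible_det_nz invertible_def)
  then have "Y = mat 1"
    by (metis YK matrix_mul_assoc matrix_mul_rid)
  then have "mat \<eta> ** mat (1 / \<eta>) ** X = mat \<eta>"
    by (metis Y_def matrix_mul_assoc matrix_mul_rid)
  moreover have "mat \<eta> ** mat (1 / \<eta>) = (mat 1 :: complex ^ 'm ^ 'm)"
    using \<eta>0 by (simp add: vec_eq_iff mat_mult_nth) (simp add: mat_def)
  ultimately show thesis
    using that \<eta>(1) by simp
qed

subsection \<open>Polynomiality of the certificate\<close>

lemma poly_fun_formN: "poly_fun (\<lambda>C. formN i0 C $ j $ k)"
  by (simp add: formN_def tensor_vv_def) (intro poly_fun_intros poly_fun_vecP poly_fun_matQ)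

lemma poly_fun_adjugate:
  fixes A :: "complex ^ 'n \<Rightarrow> complex ^ 'k ^ 'k"
  assumes "\<And>i j. poly_fun (\<lambda>x. A x $ i $ j)"
  shows "poly_fun (\<lambda>x. adjugate (A x) $ j $ k)"
proof -
  have "poly_fun (\<lambda>x. (\<chi> r c. if c = j then (if r = k then 1 else 0) else A x $ r $ c) $ a $ b)" for a b
    unfolding vec_lambda_beta by (intro poly_fun_if poly_fun.const assms)
  from poly_fun_det[OF this] show ?thesis
    by (simp add: adjugate_def)
qed

lemma poly_fun_frame_vector: "poly_fun (\<lambda>C. frame_vector i0 C n $ i)"
proof -
  have R: "poly_fun (\<lambda>C. adjugate (formN i0 C) $ j $ k)" for j k
    by (intro poly_fun_adjugate poly_fun_formN)
  have "\<forall>i. poly_fun (\<lambda>C. frame_vector i0 C n $ i)"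
  proof (induction n rule: induct_nat_012)
    case 0
    then show ?case by (simp add: poly_fun_vecP)
  next
    case 1
    show ?case
      by (simp add: contr_form_def) (intro allI poly_fun_intros R)
  next
    case (ge2 n)
    then show ?case
      by (simp add: contr_def matrix_vector_mult_def) (intro allI poly_fun_intros R poly_fun_vecP | simp)+
  qed
  then show ?thesis by blast
qed

lemma poly_fun_certificate: "poly_fun (certificate i0 g)"
proof -
  have K: "poly_fun (\<lambda>C. det (frame i0 g C))"
    by (rule poly_fun_det) (simp add: frame_def poly_fun_frame_vector)
  have N: "poly_fun (\<lambda>C. det (formN i0 C))"
    by (rule poly_fun_det) (rule poly_fun_formN)
  show ?thesis
    unfolding certificate_def[abs_def] by (intro poly_fun.mult poly_fun_vecP K N)
qed

subsection \<open>A point where the certificate does not vanish\<close>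

text \<open>The index type carries no order, so \<open>g\<close> supplies the levels. Forward
  substitution along them shows that the transpose has trivial kernel.\<close>

lemma det_triangular_nonzero:
  fixes U :: "'a::field ^ 'm::finite ^ 'm" and g :: "'m \<Rightarrow> nat"
  assumes "inj g" "\<And>i j. g j < g i \<Longrightarrow> U $ i $ j = 0" "\<And>i. U $ i $ i \<noteq> 0"
  shows "det U \<noteq> 0"
proof -
  have "x = 0" if x: "transpose U *v x = 0" for x
  proof -
    have "x $ j = 0" for j
    proof (induction "g j" arbitrary: j rule: less_induct)
      case less
      have "U $ i $ j * x $ i = (if i = j then U $ j $ j * x $ j else 0)" for i
        using less assms(2)[of j i] inj_eq[OF assms(1), of i j] by (cases "g i" "g j" rule: linorder_cases) auto
      then have "(transpose U *v x) $ j = (\<Sum>i\<in>UNIV. if i = j then U $ j $ j * x $ j else 0)"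
        unfolding matrix_vector_mult_def transpose_def vec_lambda_beta by (intro sum.cong refl)
      then show ?case
        using x assms(3)[of j] by simp
    qed
    then show ?thesis by (simp add: vec_eq_iff)
  qed
  then have "\<exists>B. B ** transpose U = mat 1"
    by (simp add: matrix_left_invertible_ker)
  then have "det (transpose U) \<noteq> 0"
    by (metis det_I det_mul mult_zero_right zero_neq_one)
  then show ?thesis by simp
qed

text \<open>This is the skew adjacency matrix of an oriented path with an additional 1 in its first
  corner. The corner makes the matrix invertible in either parity and the symmetric part of rank
  one.\<close>

definition path_form :: "('m \<Rightarrow> nat) \<Rightarrow> 'a::field ^ 'm ^ 'm::finite"
  where "path_form g = (\<chi> i j. if g i = 0 \<and> g j = 0 \<or> g j = Suc (g i) then 1
    else if g i = Suc (g j) then - 1 else 0)"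

text \<open>The form raises the top level of a vector by exactly one: the only entry in a row of
  level \<open>Suc n\<close> that can meet the support of \<open>w\<close> is the -1 at level
  \<open>n\<close>.\<close>

lemma path_form_lead:
  assumes "inj g" "\<And>k. n < g k \<Longrightarrow> w $ k = 0"
  shows "Suc n < g i \<Longrightarrow> (path_form g *v w) $ i = 0"
    and "g i = Suc n \<Longrightarrow> g j = n \<Longrightarrow> (path_form g *v w) $ i = - w $ j"
proof -
  assume "Suc n < g i"
  then have "path_form g $ i $ k * w $ k = 0" for k
    using assms(2)[of k] by (auto simp: path_form_def)
  then show "(path_form g *v w) $ i = 0"
    unfolding matrix_vector_mult_def vec_lambda_beta by (intro sum.neutral ballI)
next
  assume ij: "g i = Suc n" "g j = n"
  have "path_form g $ i $ k * w $ k = (if k = j then - w $ j else 0)" for k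
    using assms(2)[of k] ij inj_eq[OF assms(1), of k j] by (auto simp: path_form_def)
  then show "(path_form g *v w) $ i = - w $ j"
    unfolding matrix_vector_mult_def vec_lambda_beta by simp
qed

lemma path_form_symmetric_part:
  assumes "inj g" "g o0 = 0"
  shows "path_form g + transpose (path_form g) = tensor_vv (2 *s axis o0 1) (axis o0 1)"
proof -
  have "g i = 0 \<longleftrightarrow> i = o0" for i
    using assms by (metis inj_eq)
  then show ?thesis
    by (auto simp: vec_eq_iff path_form_def transpose_def tensor_vv_def axis_def)
qed

text \<open>For \<open>x\<close> in the kernel, the quadratic form at \<open>x\<close> is zero, and
  only the corner contributes to it, so \<open>x $ o0 = 0\<close>. Row n then expresses the
  coordinate of level n + 1 through lower ones, which are already zero.\<close>

lemma det_path_form: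
  fixes g :: "'m::finite \<Rightarrow> nat"
  assumes g: "bij_betw g UNIV {..<CARD('m)}"
  shows "det (path_form g :: 'a::field_char_0 ^ 'm ^ 'm) \<noteq> 0"
proof -
  let ?R = "path_form g :: 'a ^ 'm ^ 'm"
  have inj: "inj g" and range: "range g = {..<CARD('m)}"
    using g by (auto simp: bij_betw_def)
  obtain o0 where o0: "g o0 = 0"
    using range by (metis lessThan_iff rangeE zero_less_card_finite)
  have "x = 0" if x: "?R *v x = 0" for x
  proof -
    have row: "(\<Sum>j\<in>UNIV. ?R $ i $ j * x $ j) = 0" for i
      using x by (simp add: vec_eq_iff matrix_vector_mult_def)
    have "(\<Sum>i\<in>UNIV. \<Sum>j\<in>UNIV. x $ i * x $ j * ?R $ i $ j)
        = (\<Sum>i\<in>UNIV. x $ i * (\<Sum>j\<in>UNIV. ?R $ i $ j * x $ j))"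
      by (simp add: sum_distrib_left mult_ac)
    also have "\<dots> = 0"
      by (simp add: row)
    finally have *: "(\<Sum>i\<in>UNIV. \<Sum>j\<in>UNIV. x $ i * x $ j * ?R $ i $ j) = 0" .
    have "(\<Sum>i\<in>UNIV. \<Sum>j\<in>UNIV. x $ i * x $ j * ?R $ j $ i)
        = (\<Sum>i\<in>UNIV. \<Sum>j\<in>UNIV. x $ i * x $ j * ?R $ i $ j)"
      by (subst sum.swap) (simp add: mult_ac)
    with * have "0 = (\<Sum>i\<in>UNIV. \<Sum>j\<in>UNIV. x $ i * x $ j * (?R + transpose ?R) $ i $ j)"
      by (simp add: sum.distrib distrib_left transpose_def)
    moreover have "x $ i * x $ j * (?R + transpose ?R) $ i $ j
        = (if j = o0 then if i = o0 then 2 * (x $ o0)\<^sup>2 else 0 else 0)" for i j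
      unfolding path_form_symmetric_part[OF inj o0]
      by (simp add: tensor_vv_def axis_def power2_eq_square)
    ultimately have "2 * (x $ o0)\<^sup>2 = 0"
      by simp
    then have x0: "x $ o0 = 0"
      by simp
    have "x $ k = 0" for k
    proof (induction "g k" arbitrary: k rule: less_induct)
      case less
      show ?case
      proof (cases "g k")
        case 0
        then show ?thesis using x0 o0 inj by (metis inj_eq)
      next
        case (Suc n)
        then obtain i where i: "g i = n"
          using range by (metis Suc_lessD lessThan_iff rangeE rangeI)
        have "?R $ i $ j * x $ j = (if j = k then x $ k else 0)" for j
          using less[of j] Suc i inj_eq[OF inj, of j k] by (auto simp: path_form_def)
        then show ?thesis
          using row[of i] by simp
      qed
    qed
    then show ?thesis by (simp add: vec_eq_iff)
  qed
  then have "\<exists>B. B ** ?R = mat 1"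
    by (simp add: matrix_left_invertible_ker)
  then show ?thesis
    by (metis det_I det_mul mult_zero_right zero_neq_one)
qed

section \<open>Contractions of tensor products and brackets\<close>

definition dot :: "'a::comm_ring_1 ^ 'm \<Rightarrow> 'a ^ 'm \<Rightarrow> 'a"
  where "dot a b = (\<Sum>i\<in>UNIV. a $ i * b $ i)"

lemma axis_nth_if: "axis k c $ i = (if i = k then c else 0)"
  by (simp add: axis_def)

lemma dot_axis: "dot (axis o0 c) z = c * z $ o0" "dot z (axis o0 c) = z $ o0 * c"
  by (simp_all add: dot_def axis_def if_distrib[of "\<lambda>x. x * _"] if_distrib[of "\<lambda>x. _ * x"] cong: if_cong)

lemma contr_linear:
  "contr (C + D) y z = contr C y z + contr D y z"
  "contr (c *s C) y z = c *s contr C y z"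
  "contr (sum F I) y z = (\<Sum>i\<in>I. contr (F i) y z)"
proof -
  show 1: "contr (C + D) y z = contr C y z + contr D y z" for C D
    by (simp add: contr_def vec_eq_iff sum.distrib algebra_simps)
  show "contr (c *s C) y z = c *s contr C y z"
    by (simp add: contr_def vec_eq_iff sum_distrib_left mult_ac)
  have "contr 0 y z = 0"
    by (simp add: contr_def vec_eq_iff)
  then show "contr (sum F I) y z = (\<Sum>i\<in>I. contr (F i) y z)"
    by (induction I rule: infinite_finite_induct) (simp_all add: 1)
qed

lemma contr_form_linear:
  "contr_form (C + D) R = contr_form C R + contr_form D R"
  "contr_form (c *s C) R = c *s contr_form C R"
  "contr_form (sum F I) R = (\<Sum>i\<in>I. contr_form (F i) R)"
proof -
  show 1: "contr_form (C + D) R = contr_form C R + contr_form D R" for C D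
    by (simp add: contr_form_def vec_eq_iff sum.distrib algebra_simps)
  show "contr_form (c *s C) R = c *s contr_form C R"
    by (simp add: contr_form_def vec_eq_iff sum_distrib_left mult_ac)
  have "contr_form 0 R = 0"
    by (simp add: contr_form_def vec_eq_iff)
  then show "contr_form (sum F I) R = (\<Sum>i\<in>I. contr_form (F i) R)"
    by (induction I rule: infinite_finite_induct) (simp_all add: 1)
qed

lemma contr_tensor:
  "contr (tensor_vm a M) y z = dot (M *v z) y *s a"
  "contr (tensor_mv M a) y z = dot a z *s (M *v y)"
  by (simp_all add: contr_def tensor_vm_def tensor_mv_def dot_def matrix_vector_mult_def vec_eq_iff
      sum_distrib_left sum_distrib_right mult_ac)

lemma contr_form_tensor:
  "contr_form (tensor_vm a M) R = (\<Sum>j\<in>UNIV. \<Sum>k\<in>UNIV. M $ j $ k * R $ j $ k) *s a"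
  "contr_form (tensor_mv M a) R = M *v (R *v a)"
  by (simp_all add: contr_form_def tensor_vm_def tensor_mv_def matrix_vector_mult_def vec_eq_iff
      sum_distrib_left sum_distrib_right mult_ac)

text \<open>Differences are written with \<open>(- 1) *s\<close> so that \<open>contr_linear\<close>
  and \<open>contr_form_linear\<close> apply term by term.\<close>

lemma bracket_vm_bracket_vv:
  "bracket_vm a (bracket_vv b c)
    = tensor_vm a (tensor_vv b c) + (- 1) *s tensor_vm a (tensor_vv c b)
      + ((- 1) *s tensor_mv (tensor_vv b c) a + tensor_mv (tensor_vv c b) a)"
  by (simp add: vec_eq_iff bracket_vm_bracket_vv_nth tensor_vm_def tensor_mv_def tensor_vv_def algebra_simps)

lemma tensor_vv_mult: "tensor_vv b c *v x = dot c x *s b"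
  by (simp add: tensor_vv_def matrix_vector_mult_def vec_eq_iff dot_def sum_distrib_left mult_ac)

lemma contr_bracket:
  "contr (bracket_vm a (bracket_vv b c)) y z
    = (dot b y * dot c z - dot c y * dot b z) *s a - dot a z *s (dot c y *s b - dot b y *s c)"
proof -
  have scale: "dot (s *s b) x = s * dot b x" for s and b x :: "'a ^ 'b"
    by (simp add: dot_def sum_distrib_left mult_ac)
  show ?thesis
    unfolding bracket_vm_bracket_vv contr_linear contr_tensor tensor_vv_mult scale
    by (simp add: vec_eq_iff algebra_simps)
qed

lemma contr_form_bracket:
  "contr_form (bracket_vm a (bracket_vv b c)) R
    = (dot b (R *v c) - dot c (R *v b)) *s a - (dot c (R *v a) *s b - dot b (R *v a) *s c)"
proof -
  have form: "(\<Sum>j\<in>UNIV. \<Sum>k\<in>UNIV. tensor_vv b c $ j $ k * R $ j $ k) = dot b (R *v c)" for b c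
    by (simp add: tensor_vv_def matrix_vector_mult_def dot_def sum_distrib_left mult_ac)
  show ?thesis
    unfolding bracket_vm_bracket_vv contr_form_linear contr_form_tensor tensor_vv_mult form
    by (simp add: vec_eq_iff algebra_simps)
qed

section \<open>The Lie element of the test point\<close>

text \<open>The coefficient \<open>- 3\<close> makes the contraction with \<open>path_form g\<close> a multiple of \<open>axis o0 1\<close>
  alone. If \<open>g\<close> does not take the value 1, which happens only for \<open>m = 1\<close>, then \<open>e1 = 0\<close>.\<close>
definition lie_witness :: "('m \<Rightarrow> nat) \<Rightarrow> 'm \<Rightarrow> ('a::comm_ring_1, 'm::finite) tensor3"
  where "lie_witness g o0 = (let e1 = (\<chi> i. if g i = 1 then 1 else 0) in
    (\<Sum>i\<in>{i. g i \<noteq> 0}. bracket_vm (axis i 1) (bracket_vv (axis o0 1) (axis i 1)))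
    + (- 3) *s bracket_vm (axis o0 1) (bracket_vv (axis o0 1) e1))"

lemma lie_witness_in_Lie3: "lie_witness g o0 \<in> Lie3"
  unfolding lie_witness_def Let_def Lie3_def
  by (intro vec.span_add vec.span_scale vec.span_sum) (auto intro!: vec.span_base)

text \<open>Each summand [e_i, [e_0, e_i]] contracts to 2 \<eta> z_i e_i, which preserves levels.
  The correction term affects only levels 0 and 1.\<close>

lemma contr_lie_witness:
  fixes z :: "'a::comm_ring_1 ^ 'm::finite"
  assumes "inj g" "g o0 = 0"
  shows "g i = 1 \<Longrightarrow> contr (lie_witness g o0) (axis o0 \<eta>) z $ i = \<eta> * (2 * z $ i - 3 * z $ o0)"
    and "1 < g i \<Longrightarrow> contr (lie_witness g o0) (axis o0 \<eta>) z $ i = 2 * \<eta> * z $ i"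
proof -
  let ?e1 = "(\<chi> i. if g i = 1 then 1 else 0) :: 'a ^ 'm"
  have g0: "g j = 0 \<longleftrightarrow> j = o0" for j
    using assms by (metis inj_eq)
  have "contr (bracket_vm (axis j 1) (bracket_vv (axis o0 1) (axis j 1))) (axis o0 \<eta>) z $ i
      = (if j = i then 2 * \<eta> * z $ i else 0)" if "g j \<noteq> 0" for j i
    unfolding contr_bracket dot_axis using that assms(2) by (auto simp: axis_nth_if algebra_simps)
  then have "contr (lie_witness g o0) (axis o0 \<eta>) z $ i
      = (\<Sum>j\<in>{j. g j \<noteq> 0}. if j = i then 2 * \<eta> * z $ i else 0)
        - 3 * contr (bracket_vm (axis o0 1) (bracket_vv (axis o0 1) ?e1)) (axis o0 \<eta>) z $ i" for i
    by (simp add: lie_witness_def Let_def contr_linear)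
  moreover have "contr (bracket_vm (axis o0 1) (bracket_vv (axis o0 1) ?e1)) (axis o0 \<eta>) z $ i
      = \<eta> * z $ o0 * ?e1 $ i" if "i \<noteq> o0" for i
    unfolding contr_bracket dot_axis using that assms(2) by (simp add: axis_nth_if)
  ultimately have eq: "contr (lie_witness g o0) (axis o0 \<eta>) z $ i = 2 * \<eta> * z $ i - 3 * (\<eta> * z $ o0 * ?e1 $ i)"
    if "i \<noteq> o0" for i
    using that by (simp add: g0)
  show "g i = 1 \<Longrightarrow> contr (lie_witness g o0) (axis o0 \<eta>) z $ i = \<eta> * (2 * z $ i - 3 * z $ o0)"
    using eq[of i] g0[of i] by (simp add: algebra_simps)
  show "1 < g i \<Longrightarrow> contr (lie_witness g o0) (axis o0 \<eta>) z $ i = 2 * \<eta> * z $ i"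
    using eq[of i] g0[of i] by simp
qed

lemma path_form_axis: "path_form g *v axis j 1 = (\<chi> i. path_form g $ i $ j)"
  by (simp add: matrix_vector_mult_def axis_def if_distrib[of "\<lambda>x. _ * x"] cong: if_cong)

text \<open>In the sum only the index of level 1 survives and gives 3 e_1. The correction gives -3
  (3 e_0 + e_1), so the e_1 parts cancel.\<close>

lemma contr_form_lie_witness:
  fixes g :: "'m::finite \<Rightarrow> nat"
  assumes "inj g" "g o0 = 0" "g o1 = 1"
  shows "contr_form (lie_witness g o0) (path_form g :: 'a::field ^ 'm ^ 'm) = axis o0 (- 9)"
proof -
  let ?e1 = "(\<chi> i. if g i = 1 then 1 else 0) :: 'a ^ 'm"
  have g0: "g j = 0 \<longleftrightarrow> j = o0" and g1: "g j = Suc 0 \<longleftrightarrow> j = o1" for j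
    using inj_eq[OF assms(1), of j o0] inj_eq[OF assms(1), of j o1] assms(2,3) by simp_all
  have ne: "o0 \<noteq> o1" using assms by auto
  have e1: "?e1 = axis o1 1"
    by (auto simp: vec_eq_iff axis_def g1)
  have "contr_form (bracket_vm (axis j 1) (bracket_vv (axis o0 1) (axis j 1))) (path_form g :: 'a ^ 'm ^ 'm) $ i
      = (if j = o1 then (if i = o1 then 3 else 0) else 0)" if "g j \<noteq> 0" for j i
    unfolding contr_form_bracket dot_axis path_form_axis
    using that assms(2,3) g1[of j] ne by (auto simp: path_form_def axis_nth_if)
  then have "contr_form (lie_witness g o0) (path_form g) $ i
      = (\<Sum>j\<in>{j. g j \<noteq> 0}. if j = o1 then (if i = o1 then 3 else 0) else (0 :: 'a))
        - 3 * contr_form (bracket_vm (axis o0 1) (bracket_vv (axis o0 1) (axis o1 1))) (path_form g) $ i" for i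
    unfolding lie_witness_def Let_def e1 contr_form_linear by simp
  moreover have "contr_form (bracket_vm (axis o0 1) (bracket_vv (axis o0 1) (axis o1 1))) (path_form g) $ i
      = (if i = o0 then 3 else if i = o1 then 1 else (0 :: 'a))" for i
    unfolding contr_form_bracket dot_axis path_form_axis
    using assms(2,3) ne by (auto simp: path_form_def axis_nth_if)
  ultimately show ?thesis
    using assms(3) ne by (auto simp: vec_eq_iff axis_def)
qed

text \<open>The terms beginning with \<open>P\<close> contract to multiples of \<open>P\<close>, and
  QP contracts to a multiple of \<open>Q *v y\<close>. So only the Lie part can leave the line of
  \<open>P\<close>.\<close>

lemma contr_exp_deg3:
  assumes "Q *v y = c *s P"
  obtains b where "contr (exp_deg3 P Q L) y z = b *s P + contr L y z"
proof
  show "contr (exp_deg3 P Q L) y z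
      = (1 / 6 * dot (tensor_vv P P *v z) y + 1 / 2 * (dot (Q *v z) y + dot P z * c)) *s P + contr L y z"
    unfolding exp_deg3_def contr_linear contr_tensor assms by (simp add: vec_eq_iff algebra_simps)
qed

text \<open>The coefficient is obtained before \<open>L\<close> is quantified, so the Lie part of
  the test point may be chosen depending on it.\<close>

lemma contr_form_exp_deg3:
  assumes "Q *v (R *v P) = c *s P"
  obtains b where "\<And>L. contr_form (exp_deg3 P Q L) R = b *s P + contr_form L R"
proof
  show "contr_form (exp_deg3 P Q L) R
      = (1 / 6 * (\<Sum>j\<in>UNIV. \<Sum>k\<in>UNIV. tensor_vv P P $ j $ k * R $ j $ k)
          + 1 / 2 * ((\<Sum>j\<in>UNIV. \<Sum>k\<in>UNIV. Q $ j $ k * R $ j $ k) + c)) *s P + contr_form L R" for L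
    unfolding exp_deg3_def contr_form_linear contr_form_tensor assms by (simp add: vec_eq_iff algebra_simps)
qed

text \<open>Multiplying the symmetric part of R by N and its transpose gives N + N^T = 2 (Ny)(Ny)^T.
  Hence N splits as a skew matrix plus the square of the vector Ny, which is how the test point
  obtains Q and P from R.\<close>

lemma symmetric_part_inverse:
  fixes N R :: "'a::comm_ring_1 ^ 'm::finite ^ 'm"
  assumes "N ** R = mat 1" "R + transpose R = tensor_vv (2 *s y) y"
  shows "transpose (N - tensor_vv (N *v y) (N *v y)) = - (N - tensor_vv (N *v y) (N *v y))"
proof -
  have "N ** (R + transpose R) ** transpose N = tensor_vv (N *v (2 *s y)) (N *v y)"
    by (simp add: assms(2) sandwich_tensor_vv)
  moreover have "N ** transpose R ** transpose N = N"
    by (metis assms(1) matrix_mul_assoc matrix_mul_rid matrix_transpose_mul transpose_mat)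
  ultimately have "transpose N + N = tensor_vv (N *v (2 *s y)) (N *v y)"
    by (simp add: sandwich_add assms(1))
  moreover have "N *v (2 *s y) = 2 *s (N *v y)"
    by (simp add: vec_eq_iff matrix_vector_mult_def sum_distrib_left mult_ac)
  ultimately have *: "N $ j $ i + N $ i $ j = 2 * ((N *v y) $ i * (N *v y) $ j)" for i j
    by (simp add: vec_eq_iff transpose_def tensor_vv_def mult.assoc)
  have "N $ j $ i - (N *v y) $ j * (N *v y) $ i = - (N $ i $ j - (N *v y) $ i * (N *v y) $ j)" for i j
    using *[of j i] by (simp add: algebra_simps)
  then show ?thesis
    unfolding vec_eq_iff transpose_def tensor_vv_def vec_lambda_beta vector_uminus_component
      vector_minus_component by blast
qed

lemma ex_certificate_nonzero:
  "\<exists>(i0 :: 'm::finite) g P Q L. transpose Q = - Q \<and> L \<in> Lie3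
     \<and> certificate i0 g (exp_deg3 P Q L :: ('a::field_char_0, 'm) tensor3) \<noteq> 0"
proof -
  obtain g :: "'m \<Rightarrow> nat" where g: "bij_betw g UNIV {..<CARD('m)}"
    using ex_bij_betw_finite_nat[of "UNIV :: 'm set"] by (auto simp: atLeast0LessThan)
  have inj: "inj g" and range: "range g = {..<CARD('m)}"
    using g by (auto simp: bij_betw_def)
  obtain o0 where o0: "g o0 = 0"
    using range by (metis lessThan_iff rangeE zero_less_card_finite)
  define R :: "'a ^ 'm ^ 'm" where "R = path_form g"
  obtain N where N: "N ** R = mat 1" "R ** N = mat 1"
    using det_path_form[OF g] unfolding R_def by (metis invertible_det_nz invertible_def)
  define P where "P = N *v axis o0 1"
  define Q where "Q = N - tensor_vv P P"
  have Q: "transpose Q = - Q"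
    unfolding Q_def P_def using N(1) path_form_symmetric_part[OF inj o0, where ?'b = 'a]
    unfolding R_def by (rule symmetric_part_inverse)
  have RP: "R *v P = axis o0 1"
    by (simp add: P_def matrix_vector_mul_assoc N)
  have "P \<noteq> 0"
    using RP by (metis axis_eq_0_iff matrix_vector_mult_0_right one_neq_zero)
  then obtain i0 where i0: "P $ i0 \<noteq> 0"
    by (auto simp: vec_eq_iff)
  define s where "s = (P $ i0)\<^sup>2"
  have s: "s \<noteq> 0"
    using i0 by (simp add: s_def)
  have vecP: "vecP i0 (exp_deg3 P Q L) = s *s P" if "L \<in> Lie3" for L
    by (simp add: vecP_exp_deg3[OF Q that] s_def)
  have formN: "formN i0 (exp_deg3 P Q L) = mat (s\<^sup>2) ** N" if "L \<in> Lie3" for L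
  proof -
    have "formN i0 (exp_deg3 P Q L) $ j $ k = (P $ i0) ^ 4 * Q $ j $ k + s * P $ j * (s * P $ k)" for j k
      by (simp add: formN_def matQ_exp_deg3[OF Q that] vecP[OF that] tensor_vv_def)
    then show ?thesis
      by (simp add: vec_eq_iff mat_mult_nth)
        (simp add: Q_def tensor_vv_def s_def power2_eq_square power4_eq_xxxx algebra_simps)
  qed
  have "(mat (s\<^sup>2) ** N) ** (mat (1 / s\<^sup>2) ** R) = mat (s\<^sup>2) ** (mat (1 / s\<^sup>2) ** (N ** R))"
    by (metis mat_mult_commute matrix_mul_assoc)
  also have "\<dots> = mat 1"
    using s by (simp add: N vec_eq_iff mat_mult_nth) (simp add: mat_def)
  finally have detN: "det (mat (s\<^sup>2) ** N) \<noteq> 0"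
    by (metis det_I det_mul mult_zero_left zero_neq_one)
  \<comment> \<open>The matrix inverse to \<open>mat (s\<^sup>2) ** N\<close> is R divided by
    \<open>s\<^sup>2\<close>, so its adjugate is \<delta> times R.\<close>
  define \<delta> where "\<delta> = det (mat (s\<^sup>2) ** N) / s\<^sup>2"
  have \<delta>: "\<delta> \<noteq> 0"
    using detN s by (simp add: \<delta>_def)
  have adj: "adjugate (mat (s\<^sup>2) ** N) = mat \<delta> ** R"
  proof -
    have "mat (s\<^sup>2) ** adjugate (mat (s\<^sup>2) ** N) = adjugate (mat (s\<^sup>2) ** N) ** (mat (s\<^sup>2) ** N) ** R"
      by (metis N(1) mat_mult_commute matrix_mul_assoc matrix_mul_rid)
    also have "\<dots> = mat (det (mat (s\<^sup>2) ** N)) ** R"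
      by (simp only: adjugate_mult[OF detN])
    finally show ?thesis
      using s by (simp add: vec_eq_iff mat_mult_nth \<delta>_def field_simps)
  qed
  have matv: "mat c ** A *v x = c *s (A *v x)" for c :: 'a and A :: "'a ^ 'm ^ 'm" and x
    by (simp add: vec_eq_iff matrix_vector_mult_def mat_mult_nth sum_distrib_left mult_ac)
  have scale: "A *v (c *s x + d *s y) = c *s (A *v x) + d *s (A *v y)"
    for c d :: 'a and A :: "'a ^ 'm ^ 'm" and x y
    by (simp add: vec_eq_iff matrix_vector_mult_def sum.distrib sum_distrib_left algebra_simps)
  \<comment> \<open>By construction N maps e_0 to P, and Q differs from N by PP^T. This is the
    hypothesis on Q that the two contraction lemmas require.\<close>
  have QRP: "Q *v axis o0 \<eta> = (\<eta> * (1 - P $ o0)) *s P" for \<eta>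
  proof -
    have "Q *v axis o0 \<eta> = \<eta> *s (Q *v axis o0 1)"
      by (simp add: vec_eq_iff matrix_vector_mult_def axis_def if_distrib[of "\<lambda>x. _ * x"] mult_ac cong: if_cong)
    moreover have "Q *v axis o0 1 = P - P $ o0 *s P"
      unfolding Q_def matrix_vector_mult_diff_rdistrib P_def[symmetric]
      by (simp add: vec_eq_iff matrix_vector_mult_def tensor_vv_def axis_def if_distrib[of "\<lambda>x. _ * x"] mult_ac cong: if_cong)
    ultimately show ?thesis
      by (simp add: vec_eq_iff algebra_simps)
  qed
  have axis_scale: "c *s axis o0 d = axis o0 (c * d)" for c d :: 'a
    by (simp add: vec_eq_iff axis_def)
  have "Q *v (mat \<delta> ** R *v P) = (\<delta> * (1 - P $ o0)) *s P"
    by (simp add: matv RP axis_scale QRP)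
  then obtain c where c: "\<And>L. contr_form (exp_deg3 P Q L) (mat \<delta> ** R) = c *s P + contr_form L (mat \<delta> ** R)"
    using contr_form_exp_deg3 by blast
  \<comment> \<open>These are the two values of \<open>l\<close> at which a diagonal entry of the triangular matrix below vanishes.\<close>
  obtain l where l: "l \<noteq> 0" "15 * l * \<delta> \<noteq> c"
    using \<delta> by (cases "c = 0") (auto intro: that[of 1] that[of "c / \<delta>"])
  define L where "L = l *s lie_witness g o0"
  have L: "L \<in> Lie3"
    using lie_witness_in_Lie3[of g o0] unfolding L_def Lie3_def by (rule vec.span_scale)
  let ?E = "exp_deg3 P Q L"
  \<comment> \<open>Triangularity is proved for the covectors: there every contribution along P
    becomes a multiple of e_0, because R maps P to e_0.\<close>
  define u where "u n = mat \<delta> ** R *v frame_vector i0 ?E n" for n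
  have u0: "u 0 = axis o0 (\<delta> * s)"
    using scale[of R s P 0 0] by (simp add: u_def vecP[OF L] matv RP axis_scale)
  have u1: "u 1 = axis o0 (c * \<delta>) + (- 9 * l * \<delta>\<^sup>2) *s (\<chi> i. path_form g $ i $ o0)" if "g o1 = 1" for o1
  proof -
    have "contr_form D (mat \<delta> ** R) = \<delta> *s contr_form D R" for D
      by (simp add: contr_form_def vec_eq_iff mat_mult_nth sum_distrib_left mult_ac)
    then have "contr_form L (mat \<delta> ** R) = \<delta> *s (l *s axis o0 (- 9))"
      unfolding L_def contr_form_linear R_def contr_form_lie_witness[OF inj o0 that, symmetric] by simp
    also have "\<dots> = (\<delta> * l * - 9) *s axis o0 1"
      by (simp add: axis_scale mult.assoc)
    finally have "frame_vector i0 ?E 1 = c *s P + (\<delta> * l * - 9) *s axis o0 1"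
      by (simp add: formN[OF L] adj c)
    then show ?thesis
      unfolding u_def matv by (simp only: scale RP, unfold R_def path_form_axis)
        (simp add: vec_eq_iff axis_nth_if power2_eq_square algebra_simps)
  qed
  have uSS: "\<exists>b. u (Suc (Suc n)) = axis o0 b + (\<delta> * l) *s (path_form g *v contr (lie_witness g o0) (axis o0 (\<delta> * s)) (u (Suc n)))" for n
  proof -
    obtain b where "contr ?E (axis o0 (\<delta> * s)) (u (Suc n)) = b *s P + contr L (axis o0 (\<delta> * s)) (u (Suc n))"
      using contr_exp_deg3[OF QRP] by blast
    moreover have "frame_vector i0 ?E (Suc (Suc n)) = contr ?E (u 0) (u (Suc n))"
      by (simp add: u_def formN[OF L] adj)
    moreover have "contr L y z = l *s contr (lie_witness g o0) y z" for y z
      by (simp add: L_def contr_linear)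
    ultimately have "frame_vector i0 ?E (Suc (Suc n))
        = b *s P + l *s contr (lie_witness g o0) (axis o0 (\<delta> * s)) (u (Suc n))"
      using u0 by simp
    then have "u (Suc (Suc n)) = axis o0 (\<delta> * b) + (\<delta> * l) *s (path_form g *v contr (lie_witness g o0) (axis o0 (\<delta> * s)) (u (Suc n)))"
      unfolding u_def[of "Suc (Suc n)"] matv
      by (simp only: scale RP, unfold R_def) (simp add: vec_eq_iff axis_nth_if algebra_simps)
    then show ?thesis by blast
  qed
  \<comment> \<open>The covector \<open>u n\<close> has top level exactly \<open>n\<close>:
    contraction with the Lie element keeps the top level, and R then raises it by one.\<close>
  have lead: "(\<forall>i. n < g i \<longrightarrow> u n $ i = 0) \<and> (\<forall>i. g i = n \<longrightarrow> u n $ i \<noteq> 0)" if "n < CARD('m)" for n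
    using that
  proof (induction n rule: induct_nat_012)
    case 0
    have "g i = 0 \<longleftrightarrow> i = o0" for i
      using inj_eq[OF inj, of i o0] o0 by simp
    then show ?case
      using \<delta> s by (simp add: u0 axis_nth_if)
  next
    case 1
    then obtain o1 where "g o1 = 1"
      using range by (metis One_nat_def lessThan_iff rangeE)
    from u1[OF this] show ?case
      using o0 \<delta> l by (auto simp: axis_def path_form_def)
  next
    case (ge2 n)
    let ?w = "contr (lie_witness g o0) (axis o0 (\<delta> * s)) (u (Suc n))"
    have IH: "Suc n < g i \<Longrightarrow> u (Suc n) $ i = 0" "g i = Suc n \<Longrightarrow> u (Suc n) $ i \<noteq> 0" for i
      using ge2 by auto
    have \<eta>: "\<delta> * s \<noteq> 0"
      using \<delta> s by simp
    have w0: "?w $ i = 0" if "Suc n < g i" for i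
      using contr_lie_witness(2)[OF inj o0, of i "\<delta> * s" "u (Suc n)"] IH(1)[OF that] that by simp
    \<comment> \<open>At level 1 the correction term mixes in the coordinate at \<open>o0\<close>.
      The choice \<open>15 * l * \<delta> \<noteq> c\<close> excludes cancellation there; on higher
      levels the factor is just \<open>2 * \<delta> * s\<close>.\<close>
    have w1: "?w $ i \<noteq> 0" if i: "g i = Suc n" for i
    proof (cases n)
      case 0
      then have gi: "g i = 1" and "i \<noteq> o0"
        using i o0 by auto
      then have u1_nth: "u 1 $ i = 9 * l * \<delta>\<^sup>2" "u 1 $ o0 = c * \<delta> - 9 * l * \<delta>\<^sup>2"
        using o0 unfolding u1[OF gi] by (simp_all add: axis_nth_if path_form_def)
      have "2 * u 1 $ i - 3 * u 1 $ o0 = 3 * \<delta> * (15 * l * \<delta> - c)"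
        unfolding u1_nth by (simp add: power2_eq_square algebra_simps)
      also have "\<dots> \<noteq> 0"
        using \<delta> l by simp
      finally show ?thesis
        using contr_lie_witness(1)[OF inj o0 gi, of "\<delta> * s" "u 1"] \<eta> 0 by simp
    next
      case (Suc k)
      then show ?thesis
        using contr_lie_witness(2)[OF inj o0, of i "\<delta> * s" "u (Suc n)"] \<eta> i IH(2)[OF i] by simp
    qed
    obtain b where b: "u (Suc (Suc n)) = axis o0 b + (\<delta> * l) *s (path_form g *v ?w)"
      using uSS by blast
    have zero: "u (Suc (Suc n)) $ i = 0" if "Suc (Suc n) < g i" for i
      using path_form_lead(1)[OF inj w0 that] that o0 by (auto simp: b axis_nth_if)
    have "u (Suc (Suc n)) $ i \<noteq> 0" if i: "g i = Suc (Suc n)" for i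
    proof -
      have "Suc n < CARD('m)"
        using ge2.prems by simp
      then obtain j where j: "g j = Suc n"
        using range by (metis lessThan_iff rangeE)
      show ?thesis
        using path_form_lead(2)[OF inj w0 i j] w1[OF j] \<delta> l(1) i o0 by (auto simp: b axis_nth_if)
    qed
    with zero show ?case by blast
  qed
  \<comment> \<open>The triangular matrix is a multiple of R times the frame, so its nonzero
    determinant forces that of the frame to be nonzero.\<close>
  have "mat \<delta> ** R ** frame i0 g ?E = (\<chi> i j. u (g j) $ i)"
    by (simp add: vec_eq_iff u_def frame_def matrix_matrix_mult_def matrix_vector_mult_def)
  moreover have "det (\<chi> i j. u (g j) $ i) \<noteq> 0"
  proof (rule det_triangular_nonzero[OF inj])
    have "g j < CARD('m)" for j
      using range by auto
    then show "\<And>i j. g j < g i \<Longrightarrow> (\<chi> i j. u (g j) $ i) $ i $ j = 0" "\<And>i. (\<chi> i j. u (g j) $ i) $ i $ i \<noteq> 0"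
      using lead by simp_all
  qed
  ultimately have "det (frame i0 g ?E) \<noteq> 0"
    by (metis det_mul mult_zero_right)
  then have "certificate i0 g ?E \<noteq> 0"
    using i0 s detN by (simp add: certificate_def vecP[OF L] formN[OF L])
  then show ?thesis
    using Q L by blast
qed

subsection \<open>Generic triviality of the stabilizer\<close>

lemma mat_in_GL_stabilizer:
  fixes C :: "('a::field, 'm::finite) tensor3"
  assumes "\<eta> ^ 3 = 1"
  shows "mat \<eta> \<in> GL_stabilizer C"
proof -
  have "act1 (mat 1) D = D" "act2 (mat 1) D = D" "act3 (mat 1) D = D" for D :: "('a, 'm) tensor3"
    by (simp_all add: act1_def act2_def act3_def mat_def vec_eq_iff if_distrib[of "\<lambda>x. _ * x"] cong: if_cong)
  then have "congruence C (mat \<eta>) = C"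
    using congruence_mat_mult[of C \<eta> "mat 1"] assms by (simp add: congruence_eq_act)
  moreover have "mat \<eta> ** mat (\<eta>\<^sup>2) = (mat 1 :: 'a ^ 'm ^ 'm)"
    using assms by (simp add: vec_eq_iff mat_mult_nth) (simp add: mat_def power3_eq_cube power2_eq_square mult.assoc)
  then have "invertible (mat \<eta> :: 'a ^ 'm ^ 'm)"
    unfolding invertible_def using mat_mult_commute by metis
  ultimately show ?thesis
    by (simp add: GL_stabilizer_def)
qed

lemma congruence_complexify:
  "congruence (complexify C) (\<chi> i j. complex_of_real (X $ i $ j)) = complexify (congruence C X)"
  by (simp add: congruence_def complexify_def vec_eq_iff)

theorem theorem5p2:
  "holds_generically (universal_variety :: (complex, 'm::finite) tensor3 set)
     (\<lambda>C. GL_stabilizer C = {mat \<eta> | \<eta>. \<eta> ^ 3 = 1})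
   \<and>
   holds_generically (universal_variety :: (complex, 'm) tensor3 set)
     (\<lambda>C. \<forall>C' :: (real, 'm) tensor3. C = complexify C' \<longrightarrow>
        GL_stabilizer C' = {mat \<eta> | \<eta>. \<eta> ^ 3 = 1})"
proof -
  obtain i0 :: 'm and g P Q and L :: "(complex, 'm) tensor3"
    where PQL: "transpose Q = - Q" "L \<in> Lie3" "certificate i0 g (exp_deg3 P Q L) \<noteq> 0"
    using ex_certificate_nonzero by blast
  let ?V = "universal_variety :: (complex, 'm) tensor3 set"
  \<comment> \<open>One exceptional set serves both fields; the test point shows that it is
    proper.\<close>
  let ?Z = "?V \<inter> {C. certificate i0 g C = 0}"
  have closed: "zariski_closed ?Z"
    unfolding universal_variety_def
    by (intro zariski_closed_Int zariski_closed_hull zariski_closed_zero_set poly_fun_certificate)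
  have "exp_deg3 P Q L \<in> ?V"
    unfolding universal_variety_def using PQL by (intro hull_inc) blast
  then have proper: "?Z \<subset> ?V"
    using PQL(3) by blast
  have fixed: "\<exists>\<eta>. \<eta> ^ 3 = 1 \<and> X = mat \<eta>" if "C \<in> ?V - ?Z" "congruence C X = C" for C X
    using congruence_fixed_imp_mat[of C i0 g X] that by blast
  have "GL_stabilizer C = {mat \<eta> | \<eta>. \<eta> ^ 3 = 1}" if "C \<in> ?V - ?Z" for C
    using fixed[OF that] mat_in_GL_stabilizer[of _ C] by (auto simp: GL_stabilizer_def)
  \<comment> \<open>A real stabilizing matrix also stabilizes after complexification, hence is
    scalar over the complex numbers. Its scalar is a diagonal entry of the real matrix, so it is
    real.\<close>
  moreover have "GL_stabilizer C = {mat \<eta> | \<eta>. \<eta> ^ 3 = 1}" if C: "complexify C \<in> ?V - ?Z" for C :: "(real, 'm) tensor3"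
  proof -
    have "\<exists>\<eta>. X = mat \<eta> \<and> \<eta> ^ 3 = 1" if X: "congruence C X = C" for X
    proof -
      obtain \<eta> where \<eta>: "\<eta> ^ 3 = 1" "(\<chi> i j. complex_of_real (X $ i $ j)) = mat \<eta>"
        using fixed[OF C] congruence_complexify[of C X] X by metis
      then have X': "complex_of_real (X $ i $ j) = (if i = j then \<eta> else 0)" for i j
        by (simp add: vec_eq_iff mat_def)
      have \<eta>_real: "\<eta> = complex_of_real (X $ i0 $ i0)"
        using X'[of i0 i0] by simp
      have "X $ i $ j = (if i = j then X $ i0 $ i0 else 0)" for i j
        using X'[of i j] unfolding \<eta>_real by (simp split: if_splits)
      then have "X = mat (X $ i0 $ i0)"
        unfolding vec_eq_iff mat_def vec_lambda_beta by blast
      moreover have "(X $ i0 $ i0) ^ 3 = 1"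
        using \<eta>(1) unfolding \<eta>_real by (simp flip: of_real_power)
      ultimately show ?thesis by blast
    qed
    then show ?thesis
      using mat_in_GL_stabilizer[of _ C] by (auto simp: GL_stabilizer_def)
  qed
  ultimately show ?thesis
    unfolding holds_generically_def using closed proper by (intro conjI exI[of _ ?Z]) auto
qed

end
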